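(* For all $\mu,\tilde\mu,\nu,\tilde\nu\in\mathcal P_2(\mathbb R)$, $$\mathcal W_2\big(\mathcal I(\mu,\nu),\mathcal I(\tilde\mu,\tilde\nu)\big)\le\overline{\mathcal W}_2(\mu,\tilde\mu)+\mathcal W_2(\nu,\tilde\nu).$$
   Context: $\mathcal P_2(\mathbb R)$ is the set of probability measures on $\mathbb R$ with finite second moment and $\mathcal W_2$ is the quadratic Wasserstein distance. For $\eta\in\mathcal P_2(\mathbb R)$, $m(\eta)=\int x\,\eta(dx)$. The centered Wasserstein distance is $\overline{\mathcal W}_2(\mu,\nu)=\left(\mathcal W_2^2(\mu,\nu)-|m(\mu)-m(\nu)|^2\right)^{1/2}$. The convex order is defined by $\mu\le_{cx}\nu$ iff $\int f\,d\mu\le\int f\,d\nu$ for every convex $f:\mathbb R\to\mathbb R$. $\mathcal I(\mu,\nu)$ denotes the (existing and unique) minimizer of $\eta\mapsto\mathcal W_2(\mu,\eta)$ over $\{\eta\in\mathcal P_2(\mathbb R):\eta\le_{cx}\nu\}$ (in dimension one the $\mathcal W_\rho$-projection does not depend on $\rho>1$, so the index is dropped). *)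

theory Defs
  imports "HOL-Probability.Probability"
begin

definition P2 :: "real measure set" where
  "P2 = {\<mu>. prob_space \<mu> \<and> sets \<mu> = sets borel \<and> integrable \<mu> (\<lambda>x. x\<^sup>2)}"

definition mean :: "real measure \<Rightarrow> real" where
  "mean \<eta> = (\<integral>x. x \<partial>\<eta>)"

definition couplings :: "real measure \<Rightarrow> real measure \<Rightarrow> (real \<times> real) measure set" where
  "couplings \<mu> \<nu> =
     {\<pi>. prob_space \<pi> \<and> sets \<pi> = sets borel \<and> distr \<pi> borel fst = \<mu> \<and> distr \<pi> borel snd = \<nu>}"

text \<open>The infimum is finite for \<open>\<mu>, \<nu> \<in> P2\<close>, so that \<open>enn2real\<close> loses nothing there.\<close>

definition W2 :: "real measure \<Rightarrow> real measure \<Rightarrow> real" where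
  "W2 \<mu> \<nu> = sqrt (enn2real (INF \<pi>\<in>couplings \<mu> \<nu>. \<integral>\<^sup>+p. ennreal (\<bar>fst p - snd p\<bar>\<^sup>2) \<partial>\<pi>))"

definition centered_W2 :: "real measure \<Rightarrow> real measure \<Rightarrow> real" where
  "centered_W2 \<mu> \<nu> = sqrt ((W2 \<mu> \<nu>)\<^sup>2 - \<bar>mean \<mu> - mean \<nu>\<bar>\<^sup>2)"

text \<open>
  A convex function need not be integrable with respect to a measure in \<open>P2\<close>, but its negative
  part is, because the function has an affine minorant. Its integral is therefore well defined in
  \<open>(-\<infinity>, \<infinity>]\<close>; the Bochner integral, which is 0 for non-integrable functions, would be wrong here.
\<close>

definition ext_integral :: "'a measure \<Rightarrow> ('a \<Rightarrow> real) \<Rightarrow> ereal" where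
  "ext_integral M f =
     enn2ereal (\<integral>\<^sup>+x. ennreal (f x) \<partial>M) - enn2ereal (\<integral>\<^sup>+x. ennreal (- f x) \<partial>M)"

definition convex_order :: "real measure \<Rightarrow> real measure \<Rightarrow> bool" (infix "\<le>cx" 50) where
  "\<mu> \<le>cx \<nu> \<longleftrightarrow> (\<forall>f :: real \<Rightarrow> real. convex_on UNIV f \<longrightarrow> ext_integral \<mu> f \<le> ext_integral \<nu> f)"

text \<open>Since \<open>THE\<close> is unspecified otherwise, facts about \<open>cx_projection\<close> rest on existence and
  uniqueness of the minimizer for \<open>\<mu>, \<nu> \<in> P2\<close>.\<close>

definition cx_projection :: "real measure \<Rightarrow> real measure \<Rightarrow> real measure" where
  "cx_projection \<mu> \<nu> = (THE \<eta>. is_arg_min (W2 \<mu>) (\<lambda>\<eta>. \<eta> \<in> P2 \<and> \<eta> \<le>cx \<nu>) \<eta>)"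

end

theory Submission
  imports Defs
begin

text \<open>
  Let \<open>u\<close> and \<open>v\<close> be the quantile functions of \<open>\<mu>\<close> and \<open>\<nu>\<close>. The map sending a measure to its quantile
  function is an isometry of \<open>P2\<close> onto the convex cone \<open>K\<close> of nondecreasing functions in
  \<open>L\<^sup>2(0, 1)\<close>, and \<open>\<eta> \<le>cx \<nu>\<close> means that \<open>quantile \<eta> - v\<close> lies in the polar cone of \<open>K\<close>. If \<open>z\<close> is the
  projection of \<open>u - v\<close> onto \<open>K\<close>, then \<open>w = u - z\<close> is therefore the projection of \<open>u\<close> onto \<open>v\<close> plus the
  polar cone. Moreover \<open>w\<close> is again nondecreasing, so that it is the quantile function of the
  projection of \<open>\<mu>\<close>.

  For two such pairs, Moreau's decomposition \<open>u - v = z + b\<close> gives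
  \<open>\<langle>(z - z') - c, b - b'\<rangle> \<ge> 0\<close> for all constants \<open>c\<close>, because constants belong to \<open>K\<close> with both signs.
  As \<open>z = u - w\<close> and \<open>b = w - v\<close>, this places \<open>w - w'\<close> in the ball with diameter from \<open>u - u' - c\<close> to
  \<open>v - v'\<close>, and choosing \<open>c\<close> as the mean of \<open>u - u'\<close> turns the norm of the first end point into
  \<open>centered_W2 \<mu> \<mu>'\<close>.
\<close>

subsection \<open>Square integrable functions\<close>

definition square_integrable :: "'a measure \<Rightarrow> ('a \<Rightarrow> real) \<Rightarrow> bool" where
  "square_integrable M f \<longleftrightarrow> f \<in> borel_measurable M \<and> integrable M (\<lambda>x. (f x)\<^sup>2)"

definition l2norm :: "'a measure \<Rightarrow> ('a \<Rightarrow> real) \<Rightarrow> real" where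
  "l2norm M f = sqrt (\<integral>x. (f x)\<^sup>2 \<partial>M)"

lemma square_integrable_measurable [measurable_dest]:
  "square_integrable M f \<Longrightarrow> f \<in> borel_measurable M"
  by (simp add: square_integrable_def)

lemma square_integrable_square: "square_integrable M f \<Longrightarrow> integrable M (\<lambda>x. (f x)\<^sup>2)"
  by (simp add: square_integrable_def)

lemma square_integrable_mult:
  assumes "square_integrable M f" "square_integrable M g"
  shows "integrable M (\<lambda>x. f x * g x)"
proof (rule Bochner_Integration.integrable_bound)
  show "integrable M (\<lambda>x. (f x)\<^sup>2 + (g x)\<^sup>2)"
    using assms by (auto simp: square_integrable_def)
  have "\<bar>a * b\<bar> \<le> a\<^sup>2 + b\<^sup>2" for a b :: real
    using sum_squares_bound[of "\<bar>a\<bar>" "\<bar>b\<bar>"] abs_ge_zero[of "a * b"]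
    by (simp only: power2_abs abs_mult mult.assoc)
  then show "AE x in M. norm (f x * g x) \<le> norm ((f x)\<^sup>2 + (g x)\<^sup>2)"
    by (auto intro!: AE_I2)
qed (use assms in measurable)

lemma square_integrable_bound:
  assumes "square_integrable M g" "f \<in> borel_measurable M" "AE x in M. \<bar>f x\<bar> \<le> \<bar>g x\<bar>"
  shows "square_integrable M f"
  unfolding square_integrable_def
proof (intro conjI assms(2) Bochner_Integration.integrable_bound[OF square_integrable_square[OF assms(1)]])
  show "AE x in M. norm ((f x)\<^sup>2) \<le> norm ((g x)\<^sup>2)"
    using assms(3) by eventually_elim (simp add: abs_le_square_iff)
qed (use assms in measurable)

lemma square_integrable_add:
  assumes "square_integrable M f" "square_integrable M g"
  shows "square_integrable M (\<lambda>x. f x + g x)"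
  using assms square_integrable_mult[OF assms]
  by (auto simp: square_integrable_def power2_sum mult.assoc)

lemma square_integrable_cmult:
  assumes "square_integrable M f"
  shows "square_integrable M (\<lambda>x. c * f x)"
  using assms by (auto simp: square_integrable_def power_mult_distrib)

lemma square_integrable_diff:
  assumes "square_integrable M f" "square_integrable M g"
  shows "square_integrable M (\<lambda>x. f x - g x)"
  using square_integrable_add[OF assms(1) square_integrable_cmult[OF assms(2), of "-1"]] by simp

lemma (in finite_measure) square_integrable_const: "square_integrable M (\<lambda>_. c)"
  by (simp add: square_integrable_def)

lemma (in finite_measure) square_integrable_integrable:
  "square_integrable M f \<Longrightarrow> integrable M f"
  using square_integrable_mult[OF _ square_integrable_const[of 1]] by simp

lemma l2norm_nonneg: "0 \<le> l2norm M f"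
  by (simp add: l2norm_def)

lemma l2norm_power2: "(l2norm M f)\<^sup>2 = (\<integral>x. (f x)\<^sup>2 \<partial>M)"
  by (simp add: l2norm_def)

lemma l2norm_cmult: "l2norm M (\<lambda>x. c * f x) = \<bar>c\<bar> * l2norm M f"
  by (simp add: l2norm_def power_mult_distrib real_sqrt_mult)

text \<open>Cauchy-Schwarz by weighting: integrating \<open>(t * f - g)^2 / t >= 0\<close> bounds
  twice the inner product by \<open>t * a^2 + b^2 / t\<close>, and the weight
  \<open>t = b / a\<close> balances the two terms.\<close>

lemma integral_mult_le_l2norm:
  assumes f: "square_integrable M f" and g: "square_integrable M g"
  shows "(\<integral>x. f x * g x \<partial>M) \<le> l2norm M f * l2norm M g"
proof -
  define a b where "a = l2norm M f" and "b = l2norm M g"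
  have ab: "0 \<le> a" "0 \<le> b" by (auto simp: a_def b_def l2norm_nonneg)
  note [simp] = square_integrable_square[OF f] square_integrable_square[OF g] square_integrable_mult[OF f g]
  have *: "2 * (\<integral>x. f x * g x \<partial>M) \<le> t * a\<^sup>2 + b\<^sup>2 / t" if t: "t > 0" for t
  proof -
    have "0 \<le> (\<integral>x. (t * f x - g x)\<^sup>2 / t \<partial>M)"
      using t by (intro integral_nonneg_AE) auto
    also have "\<dots> = (\<integral>x. t * (f x)\<^sup>2 + (g x)\<^sup>2 / t - 2 * (f x * g x) \<partial>M)"
      using t by (intro Bochner_Integration.integral_cong) (auto simp: power2_eq_square field_simps)
    also have "\<dots> = t * a\<^sup>2 + b\<^sup>2 / t - 2 * (\<integral>x. f x * g x \<partial>M)"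
      by (simp add: a_def b_def l2norm_power2)
    finally show ?thesis by simp
  qed
  \<comment> \<open>The balancing weight \<open>b / a\<close> breaks down when a norm vanishes. Both
    norms are therefore enlarged by \<open>e > 0\<close>, and \<open>e\<close> tends to 0
    afterwards.\<close>
  have "(\<integral>x. f x * g x \<partial>M) \<le> (a + e) * (b + e)" if e: "e > 0" for e
  proof -
    have "2 * (\<integral>x. f x * g x \<partial>M) \<le> (b + e) / (a + e) * a\<^sup>2 + b\<^sup>2 / ((b + e) / (a + e))"
      using ab e by (intro *) (simp add: add_nonneg_pos)
    also have "\<dots> \<le> (b + e) / (a + e) * (a + e)\<^sup>2 + (b + e)\<^sup>2 / ((b + e) / (a + e))"
      using ab e by (intro add_mono mult_left_mono divide_right_mono power_mono) auto
    also have "\<dots> = 2 * ((a + e) * (b + e))"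
      using ab e by (simp add: power2_eq_square)
    finally show ?thesis by simp
  qed
  then have "\<forall>\<^sub>F e in at_right 0. (\<integral>x. f x * g x \<partial>M) \<le> (a + e) * (b + e)"
    by (auto simp: eventually_at_right_less eventually_at_filter)
  moreover have "((\<lambda>e. (a + e) * (b + e)) \<longlongrightarrow> (a + 0) * (b + 0)) (at_right 0)"
    by (intro tendsto_intros)
  ultimately have "(\<integral>x. f x * g x \<partial>M) \<le> (a + 0) * (b + 0)"
    by (intro tendsto_lowerbound[where F="at_right 0"]) auto
  then show ?thesis by (simp add: a_def b_def)
qed

lemma l2norm_triangle:
  assumes f: "square_integrable M f" and g: "square_integrable M g"
  shows "l2norm M (\<lambda>x. f x + g x) \<le> l2norm M f + l2norm M g"
proof (rule power2_le_imp_le)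
  have "(l2norm M (\<lambda>x. f x + g x))\<^sup>2 = (l2norm M f)\<^sup>2 + (l2norm M g)\<^sup>2 + 2 * (\<integral>x. f x * g x \<partial>M)"
    using square_integrable_square[OF f] square_integrable_square[OF g] square_integrable_mult[OF f g]
    by (simp add: l2norm_power2 power2_sum mult.assoc)
  also have "\<dots> \<le> (l2norm M f + l2norm M g)\<^sup>2"
    using integral_mult_le_l2norm[OF f g] by (simp add: power2_sum)
  finally show "(l2norm M (\<lambda>x. f x + g x))\<^sup>2 \<le> (l2norm M f + l2norm M g)\<^sup>2" .
qed (simp add: l2norm_nonneg)

subsection \<open>Quantile functions\<close>

text \<open>The interval is open because a quantile function may diverge at 0 and 1.\<close>

definition unit_interval :: "real measure" where
  "unit_interval = restrict_space lborel {0<..<1}"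

text \<open>The left-continuous generalized inverse of the distribution function, in the form used
  by the locale \<open>cdf_distribution\<close>, whose facts carry over. Only arguments strictly
  between 0 and 1 are meaningful; elsewhere the set may be empty or unbounded below.\<close>

definition quantile :: "real measure \<Rightarrow> real \<Rightarrow> real" where
  "quantile \<mu> p = Inf {x. p \<le> cdf \<mu> x}"

lemma space_unit_interval [simp]: "space unit_interval = {0<..<1}"
  by (simp add: unit_interval_def space_restrict_space)

interpretation unit_interval: prob_space unit_interval
  by (auto simp: unit_interval_def emeasure_restrict_space space_restrict_space intro!: prob_spaceI)

lemma measurable_unit_interval [measurable (raw)]:
  "f \<in> borel_measurable borel \<Longrightarrow> f \<in> borel_measurable unit_interval"
  by (simp add: unit_interval_def measurable_restrict_space1)

lemma mono_on_measurable_unit_interval: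
  "mono_on {0<..<1} (f :: real \<Rightarrow> real) \<Longrightarrow> f \<in> borel_measurable unit_interval"
  using borel_measurable_mono_on_fnc[of "{0<..<1}" f]
  by (simp add: unit_interval_def cong: measurable_cong_sets sets_restrict_space_cong)

lemma integral_unit_interval:
  "(\<integral>x. f x \<partial>unit_interval) = (\<integral>x. indicator {0<..<1} x * f x \<partial>lborel)" for f :: "real \<Rightarrow> real"
  unfolding unit_interval_def by (subst integral_restrict_space) auto

lemma P2_real_distribution: "\<mu> \<in> P2 \<Longrightarrow> real_distribution \<mu>"
  by (auto simp: P2_def real_distribution_def real_distribution_axioms_def sets_eq_imp_space_eq)

context
  fixes \<mu> :: "real measure"
  assumes \<mu>: "real_distribution \<mu>"
begin

interpretation cdf_distribution \<mu>
  using \<mu> by (simp add: cdf_distribution_def)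

lemma quantile_le_iff:
  assumes "0 < p" "p < 1"
  shows "quantile \<mu> p \<le> x \<longleftrightarrow> p \<le> cdf \<mu> x"
  unfolding quantile_def by (rule pseudoinverse[OF assms, symmetric])

lemma mono_on_quantile: "mono_on {0<..<1} (quantile \<mu>)"
  using mono_I by (simp add: quantile_def[abs_def])

lemma measurable_quantile: "quantile \<mu> \<in> borel_measurable unit_interval"
  by (rule mono_on_measurable_unit_interval[OF mono_on_quantile])

lemma distr_quantile: "distr unit_interval borel (quantile \<mu>) = \<mu>"
  using distr_I_eq_M by (simp add: unit_interval_def quantile_def[abs_def])

text \<open>By the Galois connection \<open>quantile_le_iff\<close>, the arguments with quantile at
  most \<open>c\<close> are those with \<open>p <= cdf \<mu> c\<close>, a condition preserved under
  limits from the left.\<close>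

lemma quantile_left_continuous:
  assumes "0 < p" "p < 1" and "\<And>y. 0 < y \<Longrightarrow> y < p \<Longrightarrow> quantile \<mu> y \<le> c"
  shows "quantile \<mu> p \<le> c"
proof -
  have "y \<le> cdf \<mu> c" if "0 < y" "y < p" for y
    using assms that quantile_le_iff[of y c] by auto
  then have "p \<le> cdf \<mu> c"
    by (intro dense_le_bounded[OF assms(1)]) auto
  with assms show ?thesis by (simp add: quantile_le_iff)
qed

text \<open>The Galois connection turns the event into the part in the unit interval of the segment
  from \<open>cdf \<nu> t\<close> (excluded) to \<open>cdf \<mu> s\<close>. Since
  \<open>ennreal\<close> sends negative numbers to 0, the bound also covers an empty segment. It is
  the lower bound that every coupling satisfies for this quadrant, so the quantile coupling attains
  it.\<close>

lemma emeasure_quantile_le_less: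
  assumes \<nu>: "real_distribution \<nu>"
  shows "emeasure unit_interval {p \<in> space unit_interval. quantile \<mu> p \<le> s \<and> t < quantile \<nu> p}
         \<le> ennreal (cdf \<mu> s - cdf \<nu> t)"
proof -
  interpret \<nu>: cdf_distribution \<nu>
    using \<nu> by (simp add: cdf_distribution_def)
  have q\<nu>: "t < quantile \<nu> p \<longleftrightarrow> cdf \<nu> t < p" if "0 < p" "p < 1" for p
    unfolding quantile_def using \<nu>.pseudoinverse[OF that, of t] by auto
  have "{p \<in> space unit_interval. quantile \<mu> p \<le> s \<and> t < quantile \<nu> p}
    = {0<..<1} \<inter> {p. p \<le> cdf \<mu> s \<and> cdf \<nu> t < p}"
    using quantile_le_iff q\<nu> by auto
  moreover have "emeasure unit_interval ({0<..<1} \<inter> {p. p \<le> cdf \<mu> s \<and> cdf \<nu> t < p})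
     = emeasure lborel ({0<..<1} \<inter> {p. p \<le> cdf \<mu> s \<and> cdf \<nu> t < p})"
    unfolding unit_interval_def by (subst emeasure_restrict_space) auto
  moreover have "\<dots> \<le> emeasure lborel {cdf \<nu> t .. cdf \<mu> s}"
    by (intro emeasure_mono) auto
  moreover have "\<dots> \<le> ennreal (cdf \<mu> s - cdf \<nu> t)"
    by (simp add: emeasure_lborel_Icc_eq)
  ultimately show ?thesis by simp
qed

end

lemma P2_distr_iff:
  assumes "f \<in> borel_measurable M" "prob_space M"
  shows "distr M borel f \<in> P2 \<longleftrightarrow> square_integrable M f"
proof -
  interpret prob_space M by fact
  show ?thesis using assms prob_space_distr[OF assms(1)]
    by (auto simp: P2_def square_integrable_def integrable_distr_eq)
qed

lemma P2_quantile: "\<mu> \<in> P2 \<Longrightarrow> square_integrable unit_interval (quantile \<mu>)"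
  using P2_distr_iff[OF measurable_quantile unit_interval.prob_space_axioms, of \<mu>]
  by (simp add: distr_quantile P2_real_distribution)

lemma mean_quantile:
  assumes "real_distribution \<mu>"
  shows "mean \<mu> = (\<integral>p. quantile \<mu> p \<partial>unit_interval)"
proof -
  have "mean (distr unit_interval borel (quantile \<mu>)) = (\<integral>p. quantile \<mu> p \<partial>unit_interval)"
    unfolding mean_def using measurable_quantile[OF assms] by (subst integral_distr) auto
  then show ?thesis by (simp add: distr_quantile[OF assms])
qed

section \<open>Optimality of the quantile coupling\<close>

text \<open>The integrand is the indicator of the triangle \<open>x <= s <= t < y\<close>, whose
  legs have length \<open>y - x\<close>.\<close>

lemma nn_integral_triangle:
  fixes x y :: real
  assumes "x \<le> y"
  shows "(\<integral>\<^sup>+s. \<integral>\<^sup>+t. (if s \<le> t then 1 else 0) * (if x \<le> s \<and> t < y then 1 else 0) \<partial>lborel \<partial>lborel)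
    = ennreal ((y - x)\<^sup>2 / 2)"
proof -
  have "(\<integral>\<^sup>+t. (if s \<le> t then 1 else 0) * (if x \<le> s \<and> t < y then 1 else 0) \<partial>lborel)
      = ennreal (y - s) * indicator {x..y} s" for s
  proof -
    have "(\<integral>\<^sup>+t. (if s \<le> t then 1 else 0) * (if x \<le> s \<and> t < y then 1 else 0) \<partial>lborel)
        = (\<integral>\<^sup>+t. indicator (if x \<le> s then {s..<y} else {}) t \<partial>lborel)"
      by (intro nn_integral_cong) (auto simp: indicator_def)
    also have "\<dots> = emeasure lborel (if x \<le> s then {s..<y} else {})"
      by (rule nn_integral_indicator) auto
    also have "\<dots> = ennreal (y - s) * indicator {x..y} s"
      by (auto simp: indicator_def ennreal_neg)
    finally show ?thesis .
  qed
  then have "(\<integral>\<^sup>+s. \<integral>\<^sup>+t. (if s \<le> t then 1 else 0) * (if x \<le> s \<and> t < y then 1 else 0) \<partial>lborel \<partial>lborel)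
     = (\<integral>\<^sup>+s. ennreal (y - s) * indicator {x..y} s \<partial>lborel)"
    by simp
  also have "\<dots> = ennreal (- ((y - y)\<^sup>2 / 2) - (- ((y - x)\<^sup>2 / 2)))"
  proof (rule nn_integral_FTC_Icc)
    show "((\<lambda>s. - ((y - s)\<^sup>2 / 2)) has_real_derivative (y - s)) (at s)" for s :: real
      by (auto intro!: derivative_eq_intros simp: field_simps)
  qed (use assms in auto)
  finally show ?thesis by simp
qed

text \<open>For \<open>s <= t\<close> the first indicator forces \<open>x < y\<close> and the second
  \<open>y < x\<close>, so at most one triangle is present. The factor 2 cancels the half in its
  area.\<close>

lemma square_diff_eq_nn_integral:
  fixes x y :: real
  shows "ennreal ((x - y)\<^sup>2) =
    (\<integral>\<^sup>+s. \<integral>\<^sup>+t. 2 * (if s \<le> t then 1 else 0) *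
       ((if x \<le> s \<and> t < y then 1 else 0) + (if y \<le> s \<and> t < x then 1 else 0)) \<partial>lborel \<partial>lborel)"
proof -
  have *: "ennreal ((x - y)\<^sup>2) =
    (\<integral>\<^sup>+s. \<integral>\<^sup>+t. 2 * (if s \<le> t then 1 else 0) *
       ((if x \<le> s \<and> t < y then 1 else 0) + (if y \<le> s \<and> t < x then 1 else 0)) \<partial>lborel \<partial>lborel)"
    if "x \<le> y" for x y :: real
  proof -
    have "ennreal ((x - y)\<^sup>2) = 2 * ennreal ((y - x)\<^sup>2 / 2)"
      by (subst ennreal_numeral[symmetric], subst ennreal_mult'[symmetric])
         (auto simp: power2_commute)
    also have "\<dots> = 2 * (\<integral>\<^sup>+s. \<integral>\<^sup>+t. (if s \<le> t then 1 else 0) * (if x \<le> s \<and> t < y then 1 else 0) \<partial>lborel \<partial>lborel)"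
      by (simp only: nn_integral_triangle[OF that])
    also have "\<dots> = (\<integral>\<^sup>+s. \<integral>\<^sup>+t. 2 * ((if s \<le> t then 1 else 0) * (if x \<le> s \<and> t < y then 1 else 0)) \<partial>lborel \<partial>lborel)"
      by (simp add: nn_integral_cmult)
    also have "\<dots> = (\<integral>\<^sup>+s. \<integral>\<^sup>+t. 2 * (if s \<le> t then 1 else 0) *
       ((if x \<le> s \<and> t < y then 1 else 0) + (if y \<le> s \<and> t < x then 1 else 0)) \<partial>lborel \<partial>lborel)"
      using that by (intro nn_integral_cong) (auto simp: indicator_def)
    finally show ?thesis .
  qed
  show ?thesis
  proof (cases "x \<le> y")
    case False
    then show ?thesis
      using *[of y x] by (simp add: power2_commute[of x y] add.commute)
  qed (rule *)
qed

text \<open>Hoeffding's formula: the quadratic cost depends on a coupling only through the measures of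
  the quadrants, and it is monotone in them.\<close>

lemma (in sigma_finite_measure) nn_integral_square_diff:
  assumes [measurable]: "X \<in> borel_measurable M" "Y \<in> borel_measurable M"
  shows "(\<integral>\<^sup>+\<omega>. ennreal ((X \<omega> - Y \<omega> :: real)\<^sup>2) \<partial>M) =
    (\<integral>\<^sup>+s. \<integral>\<^sup>+t. 2 * (if s \<le> t then 1 else 0) *
       (emeasure M {\<omega>\<in>space M. X \<omega> \<le> s \<and> t < Y \<omega>} + emeasure M {\<omega>\<in>space M. Y \<omega> \<le> s \<and> t < X \<omega>})
     \<partial>lborel \<partial>lborel)"
proof -
  interpret L: pair_sigma_finite "lborel :: real measure" M ..
  define K :: "_ \<Rightarrow> real \<Rightarrow> real \<Rightarrow> ennreal" where "K = (\<lambda>\<omega> s t. 2 * (if s \<le> t then 1 else 0) *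
       ((if X \<omega> \<le> s \<and> t < Y \<omega> then 1 else 0) + (if Y \<omega> \<le> s \<and> t < X \<omega> then 1 else 0)))"
  have [measurable]: "(\<lambda>x. K (f x) (g x) (h x)) \<in> borel_measurable N"
    if "f \<in> measurable N M" "g \<in> borel_measurable N" "h \<in> borel_measurable N" for f g h N
    using that unfolding K_def by measurable
  have "(\<integral>\<^sup>+\<omega>. ennreal ((X \<omega> - Y \<omega>)\<^sup>2) \<partial>M) = (\<integral>\<^sup>+\<omega>. \<integral>\<^sup>+s. \<integral>\<^sup>+t. K \<omega> s t \<partial>lborel \<partial>lborel \<partial>M)"
    unfolding K_def by (simp only: square_diff_eq_nn_integral)
  also have "\<dots> = (\<integral>\<^sup>+s. \<integral>\<^sup>+\<omega>. \<integral>\<^sup>+t. K \<omega> s t \<partial>lborel \<partial>M \<partial>lborel)"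
    by (rule L.Fubini') measurable
  also have "\<dots> = (\<integral>\<^sup>+s. \<integral>\<^sup>+t. \<integral>\<^sup>+\<omega>. K \<omega> s t \<partial>M \<partial>lborel \<partial>lborel)"
    by (intro nn_integral_cong L.Fubini') measurable
  also have "\<dots> = (\<integral>\<^sup>+s. \<integral>\<^sup>+t. 2 * (if s \<le> t then 1 else 0) *
       (emeasure M {\<omega>\<in>space M. X \<omega> \<le> s \<and> t < Y \<omega>} + emeasure M {\<omega>\<in>space M. Y \<omega> \<le> s \<and> t < X \<omega>})
     \<partial>lborel \<partial>lborel)"
  proof (intro nn_integral_cong)
    fix s t :: real
    have "(\<integral>\<^sup>+\<omega>. K \<omega> s t \<partial>M) = 2 * (if s \<le> t then 1 else 0) *
      (\<integral>\<^sup>+\<omega>. indicator {\<omega>\<in>space M. X \<omega> \<le> s \<and> t < Y \<omega>} \<omega> + indicator {\<omega>\<in>space M. Y \<omega> \<le> s \<and> t < X \<omega>} \<omega> \<partial>M)"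
      unfolding K_def
      by (subst nn_integral_cmult[symmetric]) (auto intro!: nn_integral_cong simp: indicator_def)
    then show "(\<integral>\<^sup>+\<omega>. K \<omega> s t \<partial>M) = 2 * (if s \<le> t then 1 else 0) *
       (emeasure M {\<omega>\<in>space M. X \<omega> \<le> s \<and> t < Y \<omega>} + emeasure M {\<omega>\<in>space M. Y \<omega> \<le> s \<and> t < X \<omega>})"
      by (simp add: nn_integral_add)
  qed
  finally show ?thesis .
qed

text \<open>By Hoeffding's formula it suffices to compare quadrants. For any pair of variables,
  \<open>Z <= s\<close> implies \<open>Z <= s \<and> t < Z'\<close> or \<open>Z' <= t\<close>, so
  the quadrant has probability at least the difference of the two distribution functions; under the
  quantile coupling it has no more than the positive part of that.\<close>

lemma nn_integral_square_diff_quantile_le: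
  assumes "prob_space M" and [measurable]: "X \<in> borel_measurable M" "Y \<in> borel_measurable M"
  shows "(\<integral>\<^sup>+p. ennreal ((quantile (distr M borel X) p - quantile (distr M borel Y) p)\<^sup>2) \<partial>unit_interval)
    \<le> (\<integral>\<^sup>+\<omega>. ennreal ((X \<omega> - Y \<omega> :: real)\<^sup>2) \<partial>M)"
proof -
  interpret prob_space M by fact
  have dX: "real_distribution (distr M borel Z)" if "Z \<in> borel_measurable M" for Z
    using that by (intro real_distribution_distr) auto
  have *: "emeasure unit_interval {p \<in> space unit_interval. quantile (distr M borel Z) p \<le> s \<and>
        t < quantile (distr M borel Z') p} \<le> emeasure M {\<omega>\<in>space M. Z \<omega> \<le> s \<and> t < Z' \<omega>}"
    if [measurable]: "Z \<in> borel_measurable M" "Z' \<in> borel_measurable M" for Z Z' s t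
  proof -
    have "cdf (distr M borel Z) s - cdf (distr M borel Z') t \<le> prob {\<omega>\<in>space M. Z \<omega> \<le> s \<and> t < Z' \<omega>}"
    proof -
      have "cdf (distr M borel Z) s = prob {\<omega>\<in>space M. Z \<omega> \<le> s}"
        by (auto simp: cdf_def measure_distr intro!: arg_cong[where f=prob])
      also have "\<dots> \<le> prob ({\<omega>\<in>space M. Z \<omega> \<le> s \<and> t < Z' \<omega>} \<union> {\<omega>\<in>space M. Z' \<omega> \<le> t})"
        by (intro finite_measure_mono) auto
      also have "\<dots> \<le> prob {\<omega>\<in>space M. Z \<omega> \<le> s \<and> t < Z' \<omega>} + prob {\<omega>\<in>space M. Z' \<omega> \<le> t}"
        by (intro measure_subadditive) auto
      also have "prob {\<omega>\<in>space M. Z' \<omega> \<le> t} = cdf (distr M borel Z') t"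
        by (auto simp: cdf_def measure_distr intro!: arg_cong[where f=prob])
      finally show ?thesis by simp
    qed
    then have "ennreal (cdf (distr M borel Z) s - cdf (distr M borel Z') t)
        \<le> emeasure M {\<omega>\<in>space M. Z \<omega> \<le> s \<and> t < Z' \<omega>}"
      by (simp add: emeasure_eq_measure ennreal_leI)
    with emeasure_quantile_le_less[OF dX dX, OF that] show ?thesis
      by (rule order_trans)
  qed
  show ?thesis
    by (subst unit_interval.nn_integral_square_diff, (rule measurable_quantile dX assms)+,
        subst nn_integral_square_diff, (rule assms)+)
       (intro nn_integral_mono mult_left_mono add_mono * assms order_refl; simp)
qed

section \<open>The Wasserstein distance in terms of quantile functions\<close>

lemma ennreal_cost_eq:
  assumes "square_integrable M (\<lambda>x. f x - g x)"
  shows "(\<integral>\<^sup>+x. ennreal ((f x - g x)\<^sup>2) \<partial>M) = ennreal ((l2norm M (\<lambda>x. f x - g x))\<^sup>2)"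
  unfolding l2norm_power2 by (rule nn_integral_eq_integral[OF square_integrable_square[OF assms]]) simp

lemma measurable_fst_snd_borel:
  "fst \<in> borel_measurable (borel :: (real \<times> real) measure)"
  "snd \<in> borel_measurable (borel :: (real \<times> real) measure)"
  by (auto intro!: borel_measurable_continuous_onI continuous_intros)

lemma distr_Pair_couplings:
  assumes "prob_space M" and f: "f \<in> borel_measurable M" and g: "g \<in> borel_measurable M"
  shows "distr M borel (\<lambda>x. (f x, g x)) \<in> couplings (distr M borel f) (distr M borel g)"
proof -
  interpret prob_space M by fact
  have "(\<lambda>x. (f x, g x)) \<in> borel_measurable M"
    by (intro borel_measurable_Pair f g)
  then show ?thesis
    by (auto simp: couplings_def distr_distr[OF measurable_fst_snd_borel(1)]
        distr_distr[OF measurable_fst_snd_borel(2)] comp_def intro!: prob_space_distr)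
qed

lemma nn_integral_cost_distr:
  assumes f: "f \<in> borel_measurable M" and g: "g \<in> borel_measurable M"
  shows "(\<integral>\<^sup>+p. ennreal (\<bar>fst p - snd p\<bar>\<^sup>2) \<partial>distr M borel (\<lambda>x. (f x, g x)))
    = (\<integral>\<^sup>+x. ennreal ((f x - g x :: real)\<^sup>2) \<partial>M)"
proof -
  have "(\<lambda>p :: real \<times> real. \<bar>fst p - snd p\<bar>\<^sup>2) \<in> borel_measurable borel"
    by (intro borel_measurable_continuous_onI continuous_intros)
  then have "(\<lambda>p :: real \<times> real. ennreal (\<bar>fst p - snd p\<bar>\<^sup>2)) \<in> borel_measurable borel"
    by (rule measurable_compose) simp
  then show ?thesis
    by (subst nn_integral_distr[OF borel_measurable_Pair[OF f g]]) simp_all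
qed

lemma W2_distr_le:
  assumes M: "prob_space M" and f: "square_integrable M f" and g: "square_integrable M g"
  shows "W2 (distr M borel f) (distr M borel g) \<le> l2norm M (\<lambda>x. f x - g x)"
proof -
  interpret prob_space M by fact
  note [measurable] = square_integrable_measurable[OF f] square_integrable_measurable[OF g]
  let ?\<pi> = "distr M borel (\<lambda>x. (f x, g x))"
  have "?\<pi> \<in> couplings (distr M borel f) (distr M borel g)"
    by (intro distr_Pair_couplings M) measurable
  then have "(INF \<pi>\<in>couplings (distr M borel f) (distr M borel g). \<integral>\<^sup>+p. ennreal (\<bar>fst p - snd p\<bar>\<^sup>2) \<partial>\<pi>)
      \<le> (\<integral>\<^sup>+p. ennreal (\<bar>fst p - snd p\<bar>\<^sup>2) \<partial>?\<pi>)"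
    by (rule INF_lower)
  also have "\<dots> = (\<integral>\<^sup>+x. ennreal ((f x - g x)\<^sup>2) \<partial>M)"
    by (rule nn_integral_cost_distr) measurable
  also have "\<dots> = ennreal ((l2norm M (\<lambda>x. f x - g x))\<^sup>2)"
    by (rule ennreal_cost_eq[OF square_integrable_diff[OF f g]])
  finally have "enn2real (INF \<pi>\<in>couplings (distr M borel f) (distr M borel g). \<integral>\<^sup>+p. ennreal (\<bar>fst p - snd p\<bar>\<^sup>2) \<partial>\<pi>)
      \<le> (l2norm M (\<lambda>x. f x - g x))\<^sup>2"
    by (intro enn2real_leI) auto
  then show ?thesis
    unfolding W2_def by (intro real_le_lsqrt) (auto simp: l2norm_nonneg)
qed

text \<open>The isometry behind the whole argument. The joint law of the two quantile functions
  gives the upper bound, and the optimality of that coupling gives the lower bound.\<close>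

lemma W2_quantile:
  assumes \<mu>: "\<mu> \<in> P2" and \<nu>: "\<nu> \<in> P2"
  shows "W2 \<mu> \<nu> = l2norm unit_interval (\<lambda>p. quantile \<mu> p - quantile \<nu> p)" (is "_ = ?r")
proof (rule antisym)
  show "W2 \<mu> \<nu> \<le> ?r"
    using W2_distr_le[OF unit_interval.prob_space_axioms P2_quantile[OF \<mu>] P2_quantile[OF \<nu>]]
    by (simp add: distr_quantile P2_real_distribution assms)
  let ?C = "INF \<pi>\<in>couplings \<mu> \<nu>. \<integral>\<^sup>+p. ennreal (\<bar>fst p - snd p\<bar>\<^sup>2) \<partial>\<pi>"
  have cost: "(\<integral>\<^sup>+p. ennreal ((quantile \<mu> p - quantile \<nu> p)\<^sup>2) \<partial>unit_interval) = ennreal (?r\<^sup>2)"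
    by (rule ennreal_cost_eq[OF square_integrable_diff[OF P2_quantile P2_quantile]]) fact+
  have "ennreal (?r\<^sup>2) \<le> ?C"
  proof (rule INF_greatest)
    fix \<pi> assume "\<pi> \<in> couplings \<mu> \<nu>"
    then have \<pi>: "prob_space \<pi>" "sets \<pi> = sets borel"
      and m: "distr \<pi> borel fst = \<mu>" "distr \<pi> borel snd = \<nu>"
      by (auto simp: couplings_def)
    have "fst \<in> borel_measurable \<pi>" "snd \<in> borel_measurable \<pi>"
      using measurable_fst_snd_borel by (auto simp: measurable_cong_sets[OF \<pi>(2) refl])
    then show "ennreal (?r\<^sup>2) \<le> (\<integral>\<^sup>+p. ennreal (\<bar>fst p - snd p\<bar>\<^sup>2) \<partial>\<pi>)"
      using nn_integral_square_diff_quantile_le[OF \<pi>(1), of fst snd] by (simp add: m cost)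
  qed
  \<comment> \<open>Finiteness is required before passing to reals, because \<open>enn2real\<close>
    maps infinity to 0 and is monotone only below infinity.\<close>
  moreover have "?C < \<top>"
  proof -
    let ?\<pi> = "distr unit_interval borel (\<lambda>p. (quantile \<mu> p, quantile \<nu> p))"
    note [measurable] = square_integrable_measurable[OF P2_quantile[OF \<mu>]]
      square_integrable_measurable[OF P2_quantile[OF \<nu>]]
    have "?\<pi> \<in> couplings \<mu> \<nu>"
      using distr_Pair_couplings[OF unit_interval.prob_space_axioms, of "quantile \<mu>" "quantile \<nu>"]
      by (simp add: distr_quantile P2_real_distribution assms)
    then have "?C \<le> (\<integral>\<^sup>+p. ennreal (\<bar>fst p - snd p\<bar>\<^sup>2) \<partial>?\<pi>)"
      by (rule INF_lower)
    also have "\<dots> = ennreal (?r\<^sup>2)"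
      by (subst nn_integral_cost_distr) (simp_all only: measurable_quantile P2_real_distribution assms cost)
    finally show ?thesis
      by (rule order_le_less_trans) simp
  qed
  ultimately have "enn2real (ennreal (?r\<^sup>2)) \<le> enn2real ?C"
    by (rule enn2real_mono)
  then have "?r\<^sup>2 \<le> enn2real ?C"
    by simp
  then show "?r \<le> W2 \<mu> \<nu>"
    unfolding W2_def by (rule real_le_rsqrt)
qed

subsection \<open>Level sets of monotone functions\<close>

lemma integral_linear_interval:
  fixes \<alpha> c :: real
  assumes "a \<le> b"
  shows "(\<integral>s. indicator {a..b} s * (\<alpha> * s + c) \<partial>lborel) = \<alpha> / 2 * (b\<^sup>2 - a\<^sup>2) + c * (b - a)"
proof -
  have "(\<integral>s. indicator {a..b} s *\<^sub>R (\<alpha> * s + c) \<partial>lborel)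
      = (\<alpha> / 2 * b\<^sup>2 + c * b) - (\<alpha> / 2 * a\<^sup>2 + c * a)"
  proof (rule integral_FTC_atLeastAtMost)
    show "((\<lambda>s. \<alpha> / 2 * s\<^sup>2 + c * s) has_vector_derivative \<alpha> * s + c) (at s within {a..b})" for s
      unfolding has_real_derivative_iff_has_vector_derivative[symmetric]
      by (auto intro!: derivative_eq_intros)
  qed (use assms in \<open>auto intro!: continuous_intros\<close>)
  then show ?thesis by (simp add: algebra_simps)
qed

context finite_measure
begin

interpretation L: pair_sigma_finite lborel M ..

context
  fixes c f :: "'a \<Rightarrow> real" and \<alpha> N :: real and A :: "real \<Rightarrow> 'a \<Rightarrow> bool"
  assumes c: "integrable M c" and f: "f \<in> borel_measurable M"
    and fN: "\<And>x. x \<in> space M \<Longrightarrow> f x \<in> {-N..N}"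
    and A [measurable]: "Measurable.pred (lborel \<Otimes>\<^sub>M M) (\<lambda>y. A (fst y) (snd y))"
    and A_levels: "\<And>s x. x \<in> space M \<Longrightarrow> s \<in> {-N..N} \<Longrightarrow> s \<noteq> f x \<Longrightarrow> A s x \<longleftrightarrow> s < f x"
begin

text \<open>Restricting the levels to \<open>{-N..N}\<close> gives the dominating function
  \<open>\<bar>\<alpha>\<bar> * N + \<bar>c x\<bar>\<close>, which is integrable on the product.
  This is what licenses Fubini below.\<close>

lemma integrable_levels_pair:
  "integrable (lborel \<Otimes>\<^sub>M M)
     (\<lambda>(s, x). indicator {-N..N} s * ((\<alpha> * s + c x) * (if A s x then 1 else 0)))"
proof (rule Bochner_Integration.integrable_bound)
  note [measurable] = borel_measurable_integrable[OF c]
  let ?g = "\<lambda>(s, x). indicator {-N..N} s * (\<bar>\<alpha>\<bar> * N + \<bar>c x\<bar>) :: real"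
  show "integrable (lborel \<Otimes>\<^sub>M M) ?g"
  proof (rule L.Fubini_integrable)
    have "(\<lambda>s. \<integral>x. norm (?g (s, x)) \<partial>M)
        = (\<lambda>s::real. indicator {-N..N} s * (\<integral>x. \<bar>\<bar>\<alpha>\<bar> * N + \<bar>c x\<bar>\<bar> \<partial>M))"
      by (auto simp: indicator_def)
    moreover have "integrable lborel (indicator {-N..N} :: real \<Rightarrow> real)"
      by (rule integrable_real_indicator) (auto simp: emeasure_lborel_Icc_eq)
    ultimately show "integrable lborel (\<lambda>s. \<integral>x. norm (?g (s, x)) \<partial>M)"
      by (simp only: integrable_mult_left)
  qed (use c in auto)
  have "\<bar>\<alpha> * s + d\<bar> \<le> \<bar>\<bar>\<alpha>\<bar> * N + \<bar>d\<bar>\<bar>" if "- N \<le> s" "s \<le> N" for s d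
  proof -
    have "\<bar>\<alpha> * s\<bar> \<le> \<bar>\<alpha>\<bar> * N"
      using that by (auto simp: abs_mult intro!: mult_left_mono)
    then show ?thesis by linarith
  qed
  then show "AE y in lborel \<Otimes>\<^sub>M M.
    norm (case y of (s, x) \<Rightarrow> indicator {-N..N} s * ((\<alpha> * s + c x) * (if A s x then 1 else 0))) \<le> norm (?g y)"
    by (auto intro!: AE_I2 simp: indicator_def)
  show "(\<lambda>(s, x). indicator {-N..N} s * ((\<alpha> * s + c x) * (if A s x then 1 else 0)))
      \<in> borel_measurable (lborel \<Otimes>\<^sub>M M)"
    unfolding case_prod_beta by measurable
qed

lemma integrable_levels:
  "integrable lborel (\<lambda>s. indicator {-N..N} s * (\<integral>x. (\<alpha> * s + c x) * (if A s x then 1 else 0) \<partial>M))"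
  using L.integrable_fst'[OF integrable_levels_pair] by simp

text \<open>Layer-cake formula: for fixed \<open>x\<close> the left integrand is the integral of
  \<open>\<alpha> * s + c x\<close> over the levels from \<open>-N\<close> to \<open>f x\<close>.
  The predicate \<open>A\<close> is left free at \<open>s = f x\<close>, a null set of levels for
  each \<open>x\<close>, so that a level set known only up to its end point may be inserted.\<close>

lemma integral_levels:
  "(\<integral>x. \<alpha> / 2 * ((f x)\<^sup>2 - N\<^sup>2) + c x * (f x + N) \<partial>M) =
   (\<integral>s. indicator {-N..N} s * (\<integral>x. (\<alpha> * s + c x) * (if A s x then 1 else 0) \<partial>M) \<partial>lborel)"
proof -
  note [measurable] = borel_measurable_integrable[OF c]
  have "(\<integral>s. indicator {-N..N} s * ((\<alpha> * s + c x) * (if A s x then 1 else 0)) \<partial>lborel)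
      = \<alpha> / 2 * ((f x)\<^sup>2 - N\<^sup>2) + c x * (f x + N)" if x: "x \<in> space M" for x
  proof -
    have "(\<integral>s. indicator {-N..N} s * ((\<alpha> * s + c x) * (if A s x then 1 else 0)) \<partial>lborel)
       = (\<integral>s. indicator {-N..f x} s * (\<alpha> * s + c x) \<partial>lborel)"
    proof (rule integral_cong_AE)
      show "AE s in lborel. indicator {-N..N} s * ((\<alpha> * s + c x) * (if A s x then 1 else 0))
         = indicator {-N..f x} s * (\<alpha> * s + c x)"
        using AE_lborel_singleton[of "f x"]
        by eventually_elim (use fN[OF x] A_levels[OF x] in \<open>auto simp: indicator_def\<close>)
      have "Measurable.pred lborel (\<lambda>s. A (fst (s, x)) (snd (s, x)))"
        by (rule measurable_compose[OF _ A]) (use x in measurable)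
      then have [measurable]: "Measurable.pred borel (\<lambda>s. A s x)"
        by simp
      show "(\<lambda>s. indicator {-N..N} s * ((\<alpha> * s + c x) * (if A s x then 1 else 0))) \<in> borel_measurable lborel"
        by measurable
    qed simp
    also have "\<dots> = \<alpha> / 2 * ((f x)\<^sup>2 - (-N)\<^sup>2) + c x * (f x - (-N))"
      using fN[OF x] by (intro integral_linear_interval) auto
    finally show ?thesis by simp
  qed
  then have "(\<integral>x. \<alpha> / 2 * ((f x)\<^sup>2 - N\<^sup>2) + c x * (f x + N) \<partial>M) =
    (\<integral>x. \<integral>s. indicator {-N..N} s * ((\<alpha> * s + c x) * (if A s x then 1 else 0)) \<partial>lborel \<partial>M)"
    by (intro Bochner_Integration.integral_cong) auto
  also have "\<dots> = (\<integral>s. \<integral>x. indicator {-N..N} s * ((\<alpha> * s + c x) * (if A s x then 1 else 0)) \<partial>M \<partial>lborel)"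
    by (rule L.Fubini_integral[OF integrable_levels_pair])
  finally show ?thesis by simp
qed

end

end

section \<open>Truncation and testing against nondecreasing functions\<close>

text \<open>Truncation preserves monotonicity, so inequalities for bounded nondecreasing functions,
  where the layer-cake formula applies, extend to square integrable ones by dominated
  convergence.\<close>

definition clamp_real :: "real \<Rightarrow> real \<Rightarrow> real" where
  "clamp_real N y = max (- N) (min N y)"

lemma measurable_clamp_real [measurable]: "clamp_real N \<in> borel_measurable borel"
  unfolding clamp_real_def[abs_def] by measurable

lemma clamp_real_bounds: "0 \<le> N \<Longrightarrow> clamp_real N y \<in> {-N..N}"
  by (auto simp: clamp_real_def)

lemma abs_clamp_real_le: "0 \<le> N \<Longrightarrow> \<bar>clamp_real N y\<bar> \<le> \<bar>y\<bar>"
  by (auto simp: clamp_real_def)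

lemma clamp_real_mono: "x \<le> y \<Longrightarrow> clamp_real N x \<le> clamp_real N y"
  by (auto simp: clamp_real_def)

lemma clamp_real_tendsto: "(\<lambda>n. clamp_real (real n) y) \<longlonglongrightarrow> y"
proof (rule tendsto_eventually)
  have "\<forall>\<^sub>F n in sequentially. \<bar>y\<bar> \<le> real n"
    by real_asymp
  then show "\<forall>\<^sub>F n in sequentially. clamp_real (real n) y = y"
    by eventually_elim (auto simp: clamp_real_def)
qed

lemma integral_clamp_tendsto:
  assumes f: "square_integrable M f" and c: "square_integrable M c"
  shows "(\<lambda>n. \<integral>x. clamp_real (real n) (f x) * c x \<partial>M) \<longlonglongrightarrow> (\<integral>x. f x * c x \<partial>M)"
proof (rule integral_dominated_convergence)
  show "integrable M (\<lambda>x. \<bar>f x * c x\<bar>)"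
    using square_integrable_mult[OF f c] by simp
  show "AE x in M. norm (clamp_real (real n) (f x) * c x) \<le> \<bar>f x * c x\<bar>" for n
    by (auto simp: abs_mult intro!: mult_right_mono abs_clamp_real_le)
  show "AE x in M. (\<lambda>n. clamp_real (real n) (f x) * c x) \<longlonglongrightarrow> f x * c x"
    by (auto intro!: tendsto_intros clamp_real_tendsto)
qed (use assms in measurable)

lemma integral_clamp_square_tendsto:
  assumes f: "square_integrable M f"
  shows "(\<lambda>n. \<integral>x. (clamp_real (real n) (f x))\<^sup>2 \<partial>M) \<longlonglongrightarrow> (\<integral>x. (f x)\<^sup>2 \<partial>M)"
proof (rule integral_dominated_convergence)
  show "integrable M (\<lambda>x. (f x)\<^sup>2)"
    using square_integrable_square[OF f] by simp
  show "AE x in M. norm ((clamp_real (real n) (f x))\<^sup>2) \<le> (f x)\<^sup>2" for n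
    by (auto simp: abs_le_square_iff[symmetric] intro!: abs_clamp_real_le)
  show "AE x in M. (\<lambda>n. (clamp_real (real n) (f x))\<^sup>2) \<longlonglongrightarrow> (f x)\<^sup>2"
    by (auto intro!: tendsto_intros clamp_real_tendsto)
qed (use assms in measurable)

lemma mono_on_level_set:
  assumes f: "mono_on {0<..<1} (f :: real \<Rightarrow> real)"
  obtains x where "x \<in> {0..1}" "\<And>p. p \<in> {0<..<1} \<Longrightarrow> p \<noteq> x \<Longrightarrow> s < f p \<longleftrightarrow> x < p"
proof -
  \<comment> \<open>Inserting 1 keeps the set nonempty; when no argument has a value above
    \<open>s\<close>, the end point becomes 1 and the final segment beyond it is empty.\<close>
  let ?S = "insert 1 {p \<in> {0<..<1}. s < f p}"
  have bdd: "bdd_below ?S"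
    by (rule bdd_belowI[of _ 0]) auto
  have lower: "Inf ?S \<le> p" if "p \<in> ?S" for p
    using bdd that by (intro cInf_lower)
  show ?thesis
  proof (rule that[of "Inf ?S"])
    show "Inf ?S \<in> {0..1}"
      using lower[of 1] by (auto intro!: cInf_greatest)
    fix p assume p: "p \<in> {0<..<1}" "p \<noteq> Inf ?S"
    show "s < f p \<longleftrightarrow> Inf ?S < p"
    proof
      assume "s < f p" with p lower[of p] show "Inf ?S < p" by simp
    next
      assume "Inf ?S < p"
      then obtain q where q: "q \<in> ?S" "q < p"
        using cInf_lessD[of ?S p] by auto
      then have "f q \<le> f p"
        using p by (intro mono_onD[OF f]) auto
      with q p show "s < f p" by auto
    qed
  qed
qed

lemma AE_unit_interval_singleton: "AE p in unit_interval. p \<noteq> x"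
  unfolding unit_interval_def by (subst AE_restrict_space_iff) (auto intro: AE_lborel_singleton AE_mp)

text \<open>A superlevel set of a nondecreasing function is a final segment up to its end point, and
  a single point has measure zero.\<close>

lemma integral_level_set:
  assumes f: "mono_on {0<..<1} (f :: real \<Rightarrow> real)" and h: "h \<in> borel_measurable unit_interval"
  obtains x where "x \<in> {0..1}"
    "(\<integral>p. h p * (if s < f p then 1 else 0) \<partial>unit_interval) =
     (\<integral>p. h p * (if x < p then 1 else 0 :: real) \<partial>unit_interval)"
proof -
  note [measurable] = mono_on_measurable_unit_interval[OF f] h
  obtain x where x: "x \<in> {0..1}" "\<And>p. p \<in> {0<..<1} \<Longrightarrow> p \<noteq> x \<Longrightarrow> s < f p \<longleftrightarrow> x < p"
    using mono_on_level_set[OF f, of s] by blast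
  have "(\<integral>p. h p * (if s < f p then 1 else 0) \<partial>unit_interval) =
     (\<integral>p. h p * (if x < p then 1 else 0) \<partial>unit_interval)"
  proof (rule integral_cong_AE)
    show "AE p in unit_interval. h p * (if s < f p then 1 else 0) = h p * (if x < p then 1 else 0)"
      using AE_unit_interval_singleton[of x] AE_space
      by eventually_elim (use x in auto)
  qed measurable
  with x show ?thesis by (intro that)
qed

lemma mono_on_clamp_real: "mono_on S f \<Longrightarrow> mono_on S (\<lambda>x. clamp_real N (f x))"
  by (auto simp: mono_on_def intro: clamp_real_mono)

text \<open>A bounded nondecreasing function is a constant plus a nonnegative superposition of
  indicators of final segments. The constant contributes nothing since \<open>c\<close> has integral
  zero, and each segment contributes a nonnegative amount by \<open>upper\<close>.\<close>

lemma integral_mult_mono_on_nonneg: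
  assumes c: "square_integrable unit_interval c" and int: "(\<integral>p. c p \<partial>unit_interval) = 0"
    and upper: "\<And>x. x \<in> {0..1} \<Longrightarrow> 0 \<le> (\<integral>p. c p * (if x < p then 1 else 0) \<partial>unit_interval)"
    and f: "square_integrable unit_interval f" and mono: "mono_on {0<..<1} f"
  shows "0 \<le> (\<integral>p. f p * c p \<partial>unit_interval)"
proof (rule tendsto_lowerbound[OF integral_clamp_tendsto[OF f c]])
  note [measurable] = square_integrable_measurable[OF f] square_integrable_measurable[OF c]
  have "0 \<le> (\<integral>p. clamp_real N (f p) * c p \<partial>unit_interval)" if N: "0 \<le> N" for N
  proof -
    have int_fc: "integrable unit_interval (\<lambda>p. clamp_real N (f p) * c p)"
      using N by (intro square_integrable_mult[OF square_integrable_bound[OF f] c])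
        (auto simp: abs_clamp_real_le)
    \<comment> \<open>The layer-cake formula is used with \<open>\<alpha> = 0\<close>; the added
      term \<open>c p * N\<close> integrates to zero.\<close>
    have "(\<integral>p. clamp_real N (f p) * c p \<partial>unit_interval)
        = (\<integral>p. 0 / 2 * ((clamp_real N (f p))\<^sup>2 - N\<^sup>2) + c p * (clamp_real N (f p) + N) \<partial>unit_interval)"
      using int_fc unit_interval.square_integrable_integrable[OF c]
      by (simp add: distrib_left int mult.commute)
    also have "\<dots> = (\<integral>s. indicator {-N..N} s *
        (\<integral>p. (0 * s + c p) * (if s < clamp_real N (f p) then 1 else 0) \<partial>unit_interval) \<partial>lborel)"
      using clamp_real_bounds[OF N]
      by (intro unit_interval.integral_levels unit_interval.square_integrable_integrable c) auto
    also have "\<dots> \<ge> 0"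
    proof (rule integral_nonneg_AE, rule AE_I2, rule mult_nonneg_nonneg)
      fix s
      obtain x where "x \<in> {0..1}" "(\<integral>p. c p * (if s < clamp_real N (f p) then 1 else 0) \<partial>unit_interval) =
          (\<integral>p. c p * (if x < p then 1 else 0) \<partial>unit_interval)"
        by (rule integral_level_set[OF mono_on_clamp_real[OF mono], of c]) measurable
      then show "0 \<le> (\<integral>p. (0 * s + c p) * (if s < clamp_real N (f p) then 1 else 0) \<partial>unit_interval)"
        using upper[of x] by (simp only: mult_zero_left add_0)
    qed simp
    finally show ?thesis .
  qed
  then show "\<forall>\<^sub>F n in sequentially. 0 \<le> (\<integral>p. clamp_real (real n) (f p) * c p \<partial>unit_interval)"
    by simp
qed simp

subsection \<open>Projection onto the cone of nondecreasing functions\<close>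

text \<open>The contribution of the level \<open>s\<close> to the integral of
  \<open>(f p)^2 - 2 * a p * f p\<close> when the superlevel set of \<open>f\<close> at
  \<open>s\<close> is the final segment beyond \<open>x\<close>: the factor
  \<open>2 * s - 2 * a p\<close> is the derivative in \<open>s\<close> of
  \<open>s^2 - 2 * a p * s\<close>.\<close>

definition level_cost :: "(real \<Rightarrow> real) \<Rightarrow> real \<Rightarrow> real \<Rightarrow> real" where
  "level_cost a s x = (\<integral>p. (2 * s - 2 * a p) * (if x < p then 1 else 0) \<partial>unit_interval)"

text \<open>Minimizers at a given level need not be unique. Any selection is nondecreasing in
  \<open>s\<close>, so an arbitrary one serves.\<close>

definition level_point :: "(real \<Rightarrow> real) \<Rightarrow> real \<Rightarrow> real" where
  "level_point a s = (SOME x. x \<in> {0..1} \<and> (\<forall>y\<in>{0..1}. level_cost a s x \<le> level_cost a s y))"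

text \<open>The generalized inverse of \<open>level_point a\<close>: it assembles the optimal final
  segments of all levels into one function, which turns out to be the projection of \<open>a\<close>
  onto the nondecreasing functions (isotonic regression).\<close>

definition isotonic :: "(real \<Rightarrow> real) \<Rightarrow> real \<Rightarrow> real" where
  "isotonic a p = Sup {s. level_point a s < p}"

lemma integral_unit_interval_tail:
  assumes "x \<in> {0..1}"
  shows "(\<integral>p. (if x < p then 1 else 0 :: real) \<partial>unit_interval) = 1 - x"
proof -
  have "(\<integral>p. (if x < p then 1 else 0 :: real) \<partial>unit_interval) = (\<integral>p. indicator {x<..<1} p \<partial>(lborel :: real measure))"
    unfolding integral_unit_interval using assms
    by (intro Bochner_Integration.integral_cong) (auto simp: indicator_def)
  then show ?thesis using assms by simp
qed

context
  fixes a :: "real \<Rightarrow> real"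
  assumes a: "integrable unit_interval a"
begin

private lemma [measurable]: "a \<in> borel_measurable unit_interval"
  using a by (rule borel_measurable_integrable)

private lemma integrable_tail: "integrable unit_interval (\<lambda>p. a p * (if x < p then 1 else 0))"
  by (rule Bochner_Integration.integrable_bound[OF a]) auto

private definition tail :: "real \<Rightarrow> real" where
  "tail x = (\<integral>p. a p * (if x < p then 1 else 0) \<partial>unit_interval)"

private lemma tail_1: "tail 1 = 0"
proof -
  have "tail 1 = (\<integral>p. 0 \<partial>unit_interval)"
    unfolding tail_def by (intro Bochner_Integration.integral_cong) auto
  then show ?thesis by simp
qed

private lemma abs_tail_le: "\<bar>tail x\<bar> \<le> (\<integral>p. \<bar>a p\<bar> \<partial>unit_interval)"
proof -
  have "\<bar>tail x\<bar> \<le> (\<integral>p. \<bar>a p * (if x < p then 1 else 0)\<bar> \<partial>unit_interval)"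
    unfolding tail_def by (rule integral_abs_bound)
  also have "\<dots> \<le> (\<integral>p. \<bar>a p\<bar> \<partial>unit_interval)"
    using integrable_tail a by (intro integral_mono) auto
  finally show ?thesis .
qed

lemma level_cost_eq:
  assumes "x \<in> {0..1}"
  shows "level_cost a s x = 2 * s * (1 - x) - 2 * tail x"
proof -
  have ind: "integrable unit_interval (\<lambda>p. (if x < p then 1 else 0 :: real))"
    by (rule Bochner_Integration.integrable_bound[OF unit_interval.integrable_const[of "1 :: real"]]) auto
  have "level_cost a s x
     = (\<integral>p. 2 * s * (if x < p then 1 else 0) - 2 * (a p * (if x < p then 1 else 0)) \<partial>unit_interval)"
    unfolding level_cost_def by (intro Bochner_Integration.integral_cong) auto
  also have "\<dots> = 2 * s * (1 - x) - 2 * tail x"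
    using ind integrable_tail integral_unit_interval_tail[OF assms]
    by (simp add: tail_def)
  finally show ?thesis .
qed

private lemma continuous_on_tail: "continuous_on {0..1} tail"
  unfolding continuous_on_sequentially
proof (intro ballI allI impI)
  fix X x assume x: "x \<in> {0..1}" and X: "(\<forall>n. X n \<in> {0..1}) \<and> X \<longlonglongrightarrow> (x :: real)"
  show "(tail \<circ> X) \<longlonglongrightarrow> tail x"
    unfolding comp_def tail_def
  proof (rule integral_dominated_convergence[OF _ _ integrable_abs[OF a]])
    show "AE p in unit_interval. (\<lambda>n. a p * (if X n < p then 1 else 0)) \<longlonglongrightarrow> a p * (if x < p then 1 else 0)"
      using AE_unit_interval_singleton[of x]
    proof eventually_elim
      fix p :: real assume "p \<noteq> x"
      have "\<forall>\<^sub>F n in sequentially. (X n < p) = (x < p)"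
      proof (cases "x < p")
        case True
        with X show ?thesis by (auto dest: order_tendstoD)
      next
        case False
        with X \<open>p \<noteq> x\<close> have "\<forall>\<^sub>F n in sequentially. p < X n"
          by (intro order_tendstoD(1)[of X x]) auto
        then show ?thesis by eventually_elim (use False in auto)
      qed
      then show "(\<lambda>n. a p * (if X n < p then 1 else 0)) \<longlonglongrightarrow> a p * (if x < p then 1 else 0)"
        by (intro tendsto_eventually) (auto elim: eventually_mono)
    qed
  qed auto
qed

lemma level_point:
  shows level_point_bounds: "level_point a s \<in> {0..1}"
    and level_point_le: "y \<in> {0..1} \<Longrightarrow> level_cost a s (level_point a s) \<le> level_cost a s y"
proof -
  have "continuous_on {0..1} (\<lambda>x. 2 * s * (1 - x) - 2 * tail x)"
    by (intro continuous_intros continuous_on_tail)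
  then have "continuous_on {0..1} (level_cost a s)"
    by (rule continuous_on_eq) (simp add: level_cost_eq)
  then have "\<exists>x\<in>{0..1}. \<forall>y\<in>{0..1}. level_cost a s x \<le> level_cost a s y"
    by (intro continuous_attains_inf) auto
  then have "\<exists>x. x \<in> {0..1} \<and> (\<forall>y\<in>{0..1}. level_cost a s x \<le> level_cost a s y)"
    by blast
  from someI_ex[OF this] show "level_point a s \<in> {0..1}"
    "y \<in> {0..1} \<Longrightarrow> level_cost a s (level_point a s) \<le> level_cost a s y"
    unfolding level_point_def by blast+
qed

text \<open>Adding the minimality inequalities at \<open>s\<close> and \<open>s'\<close>, each
  tested with the other minimizer, cancels the tails and leaves
  \<open>(s' - s) * (?y - ?x) >= 0\<close>.\<close>

lemma level_point_mono: "mono (level_point a)"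
proof (rule monoI)
  fix s s' :: real assume "s \<le> s'"
  show "level_point a s \<le> level_point a s'"
  proof (cases "s = s'")
    case False
    with \<open>s \<le> s'\<close> have "s < s'" by simp
    let ?x = "level_point a s" and ?y = "level_point a s'"
    have "s * (1 - ?x) - tail ?x \<le> s * (1 - ?y) - tail ?y"
      "s' * (1 - ?y) - tail ?y \<le> s' * (1 - ?x) - tail ?x"
      using level_point_le[of ?y s] level_point_le[of ?x s'] level_point_bounds
      by (auto simp: level_cost_eq)
    then have "0 \<le> (s' - s) * (?y - ?x)"
      by (simp add: algebra_simps)
    with \<open>s < s'\<close> show ?thesis
      by (simp add: zero_le_mult_iff)
  qed simp
qed

text \<open>These two implications identify the superlevel set of \<open>isotonic a\<close> at
  \<open>s\<close> with the final segment beyond \<open>level_point a s\<close>, apart from ties.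
  They rest on the supremum in \<open>isotonic\<close> being taken over a nonempty set bounded
  above, which follows by comparing the minimizer with the end points 0 and 1.\<close>

lemma
  assumes p: "p \<in> {0<..<1}"
  shows level_point_less: "s < isotonic a p \<Longrightarrow> level_point a s < p"
    and level_point_ge: "isotonic a p < s \<Longrightarrow> p \<le> level_point a s"
proof -
  define B where "B = (\<integral>p. \<bar>a p\<bar> \<partial>unit_interval)"
  have B: "0 \<le> B" "\<bar>tail x\<bar> \<le> B" for x
    using abs_tail_le by (auto simp: B_def)
  have bdd: "bdd_above {s. level_point a s < p}"
  proof (rule bdd_aboveI)
    fix s assume "s \<in> {s. level_point a s < p}"
    then have less: "level_point a s < p" by simp
    show "s \<le> B / (1 - p)"
    proof (cases "s \<le> 0")
      case True
      also have "0 \<le> B / (1 - p)" using B p by auto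
      finally show ?thesis .
    next
      case False
      have "s * (1 - p) \<le> s * (1 - level_point a s)"
        using less False by (intro mult_left_mono) auto
      also have "\<dots> \<le> tail (level_point a s)"
        \<comment> \<open>The comparison is with the end point 1, whose cost is zero.\<close>
        using level_point_le[of 1 s] level_point_bounds[of s] by (simp add: level_cost_eq tail_1)
      also have "\<dots> \<le> B" using B(2)[of "level_point a s"] by linarith
      finally show ?thesis using p by (simp add: field_simps)
    qed
  qed
  have ne: "{s. level_point a s < p} \<noteq> {}"
  proof -
    \<comment> \<open>Comparison with the end point 0 gives \<open>- s * ?x <= 2 * B\<close>. This
      level is negative enough to force \<open>?x < p\<close>, and the added 1 keeps the inequality
      strict even if \<open>B = 0\<close>.\<close>
    define s where "s = - (2 * B + 1) / p"
    let ?x = "level_point a s"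
    have "- s * ?x \<le> tail ?x - tail 0"
      using level_point_le[of 0 s] level_point_bounds[of s] by (simp add: level_cost_eq algebra_simps)
    also have "\<dots> \<le> 2 * B" using B(2)[of ?x] B(2)[of 0] by linarith
    finally have "(2 * B + 1) * ?x \<le> 2 * B * p"
      using p by (simp add: s_def field_simps)
    also have "\<dots> < (2 * B + 1) * p" using p by (simp add: algebra_simps)
    finally have "?x < p" using B by (simp add: mult_less_cancel_left)
    then show ?thesis by blast
  qed
  show "level_point a s < p" if "s < isotonic a p"
  proof -
    from that obtain s' where s': "level_point a s' < p" "s < s'"
      unfolding isotonic_def less_cSup_iff[OF ne bdd] by auto
    then show ?thesis
      using monoD[OF level_point_mono, of s s'] by simp
  qed
  show "isotonic a p < s \<Longrightarrow> p \<le> level_point a s"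
    unfolding isotonic_def using cSup_upper[OF _ bdd, of s] by (auto simp: not_less[symmetric])
qed

lemma mono_on_isotonic: "mono_on {0<..<1} (isotonic a)"
proof (rule mono_onI, rule ccontr)
  fix p q :: real
  assume pq: "p \<in> {0<..<1}" "q \<in> {0<..<1}" "p \<le> q" and "\<not> isotonic a p \<le> isotonic a q"
  then obtain s where "isotonic a q < s" "s < isotonic a p"
    using dense[of "isotonic a q" "isotonic a p"] by auto
  with pq level_point_less[of p s] level_point_ge[of q s] show False by auto
qed

text \<open>Writing \<open>(f p)\<^sup>2 - 2 a p f p\<close> as an integral over the levels \<open>s < f p\<close> reduces the projection
  onto nondecreasing functions to the choice, for each \<open>s\<close>, of the left end point of the level
  set.\<close>

lemma integral_clamp_isotonic_le:
  assumes f: "mono_on {0<..<1} f" and N: "0 \<le> N"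
  defines "J \<equiv> \<lambda>g. \<integral>p. 2 / 2 * ((clamp_real N (g p))\<^sup>2 - N\<^sup>2) + (- 2 * a p) * (clamp_real N (g p) + N) \<partial>unit_interval"
  shows "J (isotonic a) \<le> J f"
proof -
  note [measurable] = mono_on_measurable_unit_interval[OF f]
    mono_on_measurable_unit_interval[OF mono_on_isotonic]
  have [measurable]: "level_point a \<in> borel_measurable borel"
    by (rule borel_measurable_mono[OF level_point_mono])
  have a2: "integrable unit_interval (\<lambda>p. - 2 * a p)" using a by simp
  \<comment> \<open>For a level in \<open>{-N..N}\<close>, truncation does not change on which side
    of the level a value lies, except for ties.\<close>
  have 1: "clamp_real N (isotonic a p) \<noteq> s \<Longrightarrow> (level_point a s < p) = (s < clamp_real N (isotonic a p))"
    if "p \<in> {0<..<1}" "s \<in> {-N..N}" for s p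
    using level_point_less[OF that(1), of s] level_point_ge[OF that(1), of s] that(2)
    by (cases "isotonic a p" s rule: linorder_cases) (auto simp: clamp_real_def max_def min_def split: if_splits)
  have [measurable]: "(\<lambda>y. snd y :: real) \<in> borel_measurable (lborel \<Otimes>\<^sub>M unit_interval)"
    by (rule measurable_compose[OF measurable_snd]) (intro measurable_unit_interval measurable_ident_sets refl)
  have 2: "Measurable.pred (lborel \<Otimes>\<^sub>M unit_interval) (\<lambda>y. level_point a (fst y) < snd y)"
    by measurable
  \<comment> \<open>The level sets of \<open>isotonic a\<close> are entered through
    \<open>level_point a\<close>, so that the integrand at each level is exactly a minimal
    \<open>level_cost\<close>.\<close>
  have eq1: "J (isotonic a) = (\<integral>s. indicator {-N..N} s *
      (\<integral>p. (2 * s + - 2 * a p) * (if level_point a s < p then 1 else 0) \<partial>unit_interval) \<partial>lborel)"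
    unfolding J_def using a2 clamp_real_bounds[OF N] 1 2
    by (intro unit_interval.integral_levels) auto
  have int1: "integrable lborel (\<lambda>s. indicator {-N..N} s *
      (\<integral>p. (2 * s + - 2 * a p) * (if level_point a s < p then 1 else 0) \<partial>unit_interval))"
    using a2 clamp_real_bounds[OF N] 1 2
    by (intro unit_interval.integrable_levels[where f="\<lambda>p. clamp_real N (isotonic a p)"]) auto
  have eq2: "J f = (\<integral>s. indicator {-N..N} s *
      (\<integral>p. (2 * s + - 2 * a p) * (if s < clamp_real N (f p) then 1 else 0) \<partial>unit_interval) \<partial>lborel)"
    unfolding J_def using a2 clamp_real_bounds[OF N]
    by (intro unit_interval.integral_levels) auto
  have int2: "integrable lborel (\<lambda>s. indicator {-N..N} s *
      (\<integral>p. (2 * s + - 2 * a p) * (if s < clamp_real N (f p) then 1 else 0) \<partial>unit_interval))"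
    using a2 clamp_real_bounds[OF N]
    by (intro unit_interval.integrable_levels[where f="\<lambda>p. clamp_real N (f p)"]) auto
  show ?thesis
    unfolding eq1 eq2
  proof (rule integral_mono[OF int1 int2], rule mult_left_mono)
    fix s
    obtain x where x: "x \<in> {0..1}" "(\<integral>p. (2 * s + - 2 * a p) * (if s < clamp_real N (f p) then 1 else 0) \<partial>unit_interval) =
          (\<integral>p. (2 * s + - 2 * a p) * (if x < p then 1 else 0) \<partial>unit_interval)"
      by (rule integral_level_set[OF mono_on_clamp_real[OF f], of "\<lambda>p. 2 * s + - 2 * a p"]) measurable
    then show "(\<integral>p. (2 * s + - 2 * a p) * (if level_point a s < p then 1 else 0) \<partial>unit_interval)
      \<le> (\<integral>p. (2 * s + - 2 * a p) * (if s < clamp_real N (f p) then 1 else 0) \<partial>unit_interval)"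
      using level_point_le[of x s] by (simp add: level_cost_def)
  qed simp
qed

end

section \<open>Variational characterization of the isotonic projection\<close>

context
  fixes a :: "real \<Rightarrow> real"
  assumes a: "square_integrable unit_interval a"
begin

private lemma a_int: "integrable unit_interval a"
  by (rule unit_interval.square_integrable_integrable[OF a])

lemma integral_clamp_isotonic_square_le:
  assumes f: "mono_on {0<..<1} f" and N: "0 \<le> N"
  defines "J \<equiv> \<lambda>g. (\<integral>p. (clamp_real N (g p))\<^sup>2 \<partial>unit_interval) - 2 * (\<integral>p. clamp_real N (g p) * a p \<partial>unit_interval)"
  shows "J (isotonic a) \<le> J f"
proof -
  \<comment> \<open>The layer-cake functional differs from \<open>J g\<close> only by terms
    independent of \<open>g\<close>, so its minimality carries over.\<close>
  have eq: "(\<integral>p. 2 / 2 * ((clamp_real N (g p))\<^sup>2 - N\<^sup>2) + (- 2 * a p) * (clamp_real N (g p) + N) \<partial>unit_interval)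
    = J g - N\<^sup>2 - 2 * N * (\<integral>p. a p \<partial>unit_interval)" if g: "mono_on {0<..<1} g" for g :: "real \<Rightarrow> real"
  proof -
    note [measurable] = mono_on_measurable_unit_interval[OF g]
    have sq: "square_integrable unit_interval (\<lambda>p. clamp_real N (g p))"
      using clamp_real_bounds[OF N]
      by (intro square_integrable_bound[OF unit_interval.square_integrable_const[of N]]) (auto simp: abs_le_iff minus_le_iff N)
    have "(\<integral>p. 2 / 2 * ((clamp_real N (g p))\<^sup>2 - N\<^sup>2) + (- 2 * a p) * (clamp_real N (g p) + N) \<partial>unit_interval)
      = (\<integral>p. (clamp_real N (g p))\<^sup>2 - N\<^sup>2 - 2 * (clamp_real N (g p) * a p) - 2 * N * a p \<partial>unit_interval)"
      by (intro Bochner_Integration.integral_cong) (auto simp: algebra_simps)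
    also have "\<dots> = J g - N\<^sup>2 - 2 * N * (\<integral>p. a p \<partial>unit_interval)"
      using square_integrable_square[OF sq] square_integrable_mult[OF sq a] a_int
      using unit_interval.prob_space by (simp add: J_def)
    finally show ?thesis .
  qed
  show ?thesis
    using integral_clamp_isotonic_le[OF a_int f N]
    unfolding eq[OF f] eq[OF mono_on_isotonic[OF a_int]] by simp
qed

text \<open>Comparing the truncated function with the competitor 0 bounds its squared norm by twice
  its inner product with \<open>a\<close>. Together with the square of
  \<open>clamp_real N (isotonic a p) - 2 * a p\<close> this gives the bound
  \<open>4 * (\<integral>p. (a p)\<^sup>2 \<partial>unit_interval)\<close>, uniform in
  \<open>N\<close>, and Fatou's lemma removes the truncation.\<close>

lemma square_integrable_isotonic: "square_integrable unit_interval (isotonic a)"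
proof -
  let ?z = "isotonic a"
  note [measurable] = mono_on_measurable_unit_interval[OF mono_on_isotonic[OF a_int]]
    square_integrable_measurable[OF a]
  have bound: "(\<integral>p. (clamp_real N (?z p))\<^sup>2 \<partial>unit_interval) \<le> 4 * (\<integral>p. (a p)\<^sup>2 \<partial>unit_interval)"
    and sq: "square_integrable unit_interval (\<lambda>p. clamp_real N (?z p))" if N: "0 \<le> N" for N
  proof -
    show sq: "square_integrable unit_interval (\<lambda>p. clamp_real N (?z p))"
      using clamp_real_bounds[OF N]
      by (intro square_integrable_bound[OF unit_interval.square_integrable_const[of N]]) (auto simp: abs_le_iff minus_le_iff N)
    have zero: "clamp_real N 0 = 0" using N by (simp add: clamp_real_def)
    note [simp] = square_integrable_square[OF sq] square_integrable_mult[OF sq a] square_integrable_square[OF a]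
    have "0 \<le> (\<integral>p. (clamp_real N (?z p) - 2 * a p)\<^sup>2 \<partial>unit_interval)"
      by (rule integral_nonneg_AE) simp
    also have "\<dots> = (\<integral>p. (clamp_real N (?z p))\<^sup>2 - 4 * (clamp_real N (?z p) * a p) + 4 * (a p)\<^sup>2 \<partial>unit_interval)"
      by (intro Bochner_Integration.integral_cong) (auto simp: power2_eq_square algebra_simps)
    also have "\<dots> = (\<integral>p. (clamp_real N (?z p))\<^sup>2 \<partial>unit_interval) - 4 * (\<integral>p. clamp_real N (?z p) * a p \<partial>unit_interval)
        + 4 * (\<integral>p. (a p)\<^sup>2 \<partial>unit_interval)"
      by simp
    finally show "(\<integral>p. (clamp_real N (?z p))\<^sup>2 \<partial>unit_interval) \<le> 4 * (\<integral>p. (a p)\<^sup>2 \<partial>unit_interval)"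
      using integral_clamp_isotonic_square_le[of "\<lambda>_. 0", OF _ N] by (simp add: zero mono_on_def)
  qed
  have "(\<integral>\<^sup>+p. ennreal ((?z p)\<^sup>2) \<partial>unit_interval)
      = (\<integral>\<^sup>+p. liminf (\<lambda>n. ennreal ((clamp_real (real n) (?z p))\<^sup>2)) \<partial>unit_interval)"
    by (intro nn_integral_cong lim_imp_Liminf[symmetric] tendsto_ennrealI tendsto_power clamp_real_tendsto) simp
  also have "\<dots> \<le> liminf (\<lambda>n. \<integral>\<^sup>+p. ennreal ((clamp_real (real n) (?z p))\<^sup>2) \<partial>unit_interval)"
    by (rule nn_integral_liminf) measurable
  also have "\<dots> \<le> ennreal (4 * (\<integral>p. (a p)\<^sup>2 \<partial>unit_interval))"
  proof (rule Liminf_le)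
    show "\<forall>\<^sub>F n in sequentially. (\<integral>\<^sup>+p. ennreal ((clamp_real (real n) (?z p))\<^sup>2) \<partial>unit_interval)
        \<le> ennreal (4 * (\<integral>p. (a p)\<^sup>2 \<partial>unit_interval))"
      using square_integrable_square[OF sq] bound
      by (subst nn_integral_eq_integral) (auto intro!: ennreal_leI)
  qed simp
  also have "\<dots> < \<infinity>" by simp
  finally show ?thesis
    unfolding square_integrable_def by (auto intro!: integrableI_nonneg)
qed

text \<open>Adding the squared norm of \<open>a\<close> turns both sides into squared distances from
  \<open>a\<close>, so \<open>isotonic a\<close> is the nearest nondecreasing function. The
  inequality is the limit of its truncated versions.\<close>

lemma isotonic_minimal:
  assumes f: "square_integrable unit_interval f" and mono: "mono_on {0<..<1} f"
  shows "(\<integral>p. (isotonic a p)\<^sup>2 \<partial>unit_interval) - 2 * (\<integral>p. isotonic a p * a p \<partial>unit_interval)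
    \<le> (\<integral>p. (f p)\<^sup>2 \<partial>unit_interval) - 2 * (\<integral>p. f p * a p \<partial>unit_interval)"
proof -
  let ?J = "\<lambda>g n. (\<integral>p. (clamp_real (real n) (g p))\<^sup>2 \<partial>unit_interval) - 2 * (\<integral>p. clamp_real (real n) (g p) * a p \<partial>unit_interval)"
  have lim: "?J g \<longlonglongrightarrow> (\<integral>p. (g p)\<^sup>2 \<partial>unit_interval) - 2 * (\<integral>p. g p * a p \<partial>unit_interval)"
    if "square_integrable unit_interval g" for g
    by (intro tendsto_intros integral_clamp_tendsto integral_clamp_square_tendsto that a)
  show ?thesis
    by (rule tendsto_le[OF _ lim[OF f] lim[OF square_integrable_isotonic]])
      (use integral_clamp_isotonic_square_le[OF mono] in simp_all)
qed

text \<open>First-order condition at the minimum: compare with \<open>isotonic a + t * g\<close>,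
  divide by \<open>t\<close> and let \<open>t\<close> tend to 0. Admissibility is asked only for
  \<open>t <= 1\<close>, which allows the direction \<open>- isotonic a\<close> as well as every
  nondecreasing \<open>g\<close>.\<close>

lemma isotonic_variation:
  assumes g: "square_integrable unit_interval g"
    and mono: "\<And>t. 0 < t \<Longrightarrow> t \<le> 1 \<Longrightarrow> mono_on {0<..<1} (\<lambda>p. isotonic a p + t * g p)"
  shows "(\<integral>p. (a p - isotonic a p) * g p \<partial>unit_interval) \<le> 0"
proof -
  let ?z = "isotonic a"
  note z = square_integrable_isotonic
  note [simp] = square_integrable_mult[OF g a] square_integrable_mult[OF z a] square_integrable_mult[OF z g]
    square_integrable_square[OF z] square_integrable_square[OF g]
  have gz: "(\<integral>p. (a p - ?z p) * g p \<partial>unit_interval)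
      = (\<integral>p. g p * a p \<partial>unit_interval) - (\<integral>p. ?z p * g p \<partial>unit_interval)"
    using square_integrable_mult[OF a g] by (simp add: left_diff_distrib mult.commute[of "g _"])
  have "2 * (\<integral>p. (a p - ?z p) * g p \<partial>unit_interval) \<le> t * (\<integral>p. (g p)\<^sup>2 \<partial>unit_interval)"
    if t: "0 < t" "t \<le> 1" for t
  proof -
    let ?f = "\<lambda>p. ?z p + t * g p"
    have "(\<integral>p. (?f p)\<^sup>2 \<partial>unit_interval) = (\<integral>p. (?z p)\<^sup>2 + 2 * t * (?z p * g p) + t\<^sup>2 * (g p)\<^sup>2 \<partial>unit_interval)"
      by (intro Bochner_Integration.integral_cong) (auto simp: power2_eq_square algebra_simps)
    also have "\<dots> = (\<integral>p. (?z p)\<^sup>2 \<partial>unit_interval) + 2 * t * (\<integral>p. ?z p * g p \<partial>unit_interval)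
        + t\<^sup>2 * (\<integral>p. (g p)\<^sup>2 \<partial>unit_interval)"
      by simp
    finally have 1: "(\<integral>p. (?f p)\<^sup>2 \<partial>unit_interval) = \<dots>" .
    have 2: "(\<integral>p. ?f p * a p \<partial>unit_interval)
        = (\<integral>p. ?z p * a p \<partial>unit_interval) + t * (\<integral>p. g p * a p \<partial>unit_interval)"
      by (simp add: distrib_right mult.assoc)
    have "t * (2 * (\<integral>p. (a p - ?z p) * g p \<partial>unit_interval)) \<le> t * (t * (\<integral>p. (g p)\<^sup>2 \<partial>unit_interval))"
      using isotonic_minimal[OF square_integrable_add[OF z square_integrable_cmult[OF g]] mono[OF t]]
      unfolding 1 2 gz by (simp add: power2_eq_square algebra_simps)
    with t show ?thesis by simp
  qed
  then have "\<forall>\<^sub>F t in at_right 0. 2 * (\<integral>p. (a p - ?z p) * g p \<partial>unit_interval) \<le> t * (\<integral>p. (g p)\<^sup>2 \<partial>unit_interval)"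
    by (auto simp: eventually_at_right_field intro!: exI[of _ 1])
  moreover have "((\<lambda>t. t * (\<integral>p. (g p)\<^sup>2 \<partial>unit_interval)) \<longlongrightarrow> 0 * (\<integral>p. (g p)\<^sup>2 \<partial>unit_interval)) (at_right 0)"
    by (intro tendsto_intros)
  ultimately have "2 * (\<integral>p. (a p - ?z p) * g p \<partial>unit_interval) \<le> 0 * (\<integral>p. (g p)\<^sup>2 \<partial>unit_interval)"
    by (intro tendsto_lowerbound[where F="at_right 0"]) auto
  then show ?thesis by simp
qed

lemma isotonic_residual_polar:
  assumes "square_integrable unit_interval f" and "mono_on {0<..<1} f"
  shows "(\<integral>p. (a p - isotonic a p) * f p \<partial>unit_interval) \<le> 0"
proof (rule isotonic_variation[OF assms(1)], rule mono_onI)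
  fix t p q :: real
  assume "0 < t" "p \<in> {0<..<1}" "q \<in> {0<..<1}" "p \<le> q"
  then show "isotonic a p + t * f p \<le> isotonic a q + t * f q"
    using mono_onD[OF mono_on_isotonic[OF a_int]] mono_onD[OF assms(2)]
    by (intro add_mono mult_left_mono) simp_all
qed

text \<open>Scaling by \<open>1 + t\<close> and by \<open>1 - t\<close> both keep
  \<open>isotonic a\<close> nondecreasing, so the variation inequality holds in the directions
  \<open>isotonic a\<close> and \<open>- isotonic a\<close>. With polarity this completes Moreau's
  decomposition of \<open>a\<close>.\<close>

lemma isotonic_residual_orthogonal:
  "(\<integral>p. (a p - isotonic a p) * isotonic a p \<partial>unit_interval) = 0"
proof (rule antisym)
  show "(\<integral>p. (a p - isotonic a p) * isotonic a p \<partial>unit_interval) \<le> 0"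
    by (rule isotonic_residual_polar[OF square_integrable_isotonic mono_on_isotonic[OF a_int]])
  have "mono_on {0<..<1} (\<lambda>p. isotonic a p + t * (- isotonic a p))" if "0 < t" "t \<le> 1" for t
  proof -
    have "isotonic a p + t * (- isotonic a p) = (1 - t) * isotonic a p" for p
      by (simp add: algebra_simps)
    then show ?thesis
      using mono_on_isotonic[OF a_int] that by (auto simp: mono_on_def intro!: mult_left_mono)
  qed
  then have "(\<integral>p. (a p - isotonic a p) * (- isotonic a p) \<partial>unit_interval) \<le> 0"
    using square_integrable_cmult[OF square_integrable_isotonic, of "-1"]
    by (intro isotonic_variation) auto
  then show "0 \<le> (\<integral>p. (a p - isotonic a p) * isotonic a p \<partial>unit_interval)"
    by simp
qed

lemma isotonic_residual_const: "(\<integral>p. (a p - isotonic a p) * c \<partial>unit_interval) = 0"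
proof -
  have "(\<integral>p. (a p - isotonic a p) * d \<partial>unit_interval) \<le> 0" for d
    by (rule isotonic_residual_polar[OF unit_interval.square_integrable_const]) (simp add: mono_on_def)
  from this[of 1] this[of "-1"] show ?thesis
    unfolding integral_mult_left_zero by simp
qed

end

section \<open>Monotonicity of \<open>u - isotonic (u - v)\<close>\<close>

lemma level_cost_diff:
  assumes a: "integrable unit_interval a" and "y \<in> {0..1}" "x \<in> {0..1}" "y \<le> x"
  shows "level_cost a s y - level_cost a s x = (\<integral>p. (2 * s - 2 * a p) * indicator {y<..x} p \<partial>unit_interval)"
proof -
  note [measurable] = borel_measurable_integrable[OF a]
  have "integrable unit_interval (\<lambda>p. 2 * s - 2 * a p)"
    using a by simp
  then have "integrable unit_interval (\<lambda>p. (2 * s - 2 * a p) * (if x < p then 1 else 0))" for x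
    by (rule Bochner_Integration.integrable_bound) simp_all
  then have "level_cost a s y - level_cost a s x = (\<integral>p. (2 * s - 2 * a p) * (if y < p then 1 else 0)
     - (2 * s - 2 * a p) * (if x < p then 1 else 0) \<partial>unit_interval)"
    unfolding level_cost_def by simp
  also have "\<dots> = (\<integral>p. (2 * s - 2 * a p) * indicator {y<..x} p \<partial>unit_interval)"
    using assms by (intro Bochner_Integration.integral_cong) (auto simp: indicator_def)
  finally show ?thesis .
qed

text \<open>If \<open>s\<close> were below \<open>c\<close>, then \<open>a\<close> would exceed
  \<open>s\<close> on the whole segment from \<open>y\<close> to \<open>x\<close>, and moving the
  end point from \<open>x\<close> down to \<open>y\<close> would change the cost by at most
  \<open>2 * (s - c) * (x - y) < 0\<close>.\<close>

lemma level_cost_slope_le: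
  assumes a: "integrable unit_interval a" and x: "y \<in> {0..1}" "x \<in> {0..1}" "y < x"
    and c: "\<And>p. p \<in> {0<..<1} \<Longrightarrow> p \<in> {y<..x} \<Longrightarrow> c \<le> a p"
    and le: "level_cost a s x \<le> level_cost a s y"
  shows "c \<le> s"
proof (rule ccontr)
  assume "\<not> c \<le> s"
  note [measurable] = borel_measurable_integrable[OF a]
  have "0 \<le> (\<integral>p. (2 * s - 2 * a p) * indicator {y<..x} p \<partial>unit_interval)"
    using le level_cost_diff[OF a x(1,2), of s] x(3) by simp
  also have "\<dots> \<le> (\<integral>p. 2 * (s - c) * indicator {y<..x} p \<partial>unit_interval)"
  proof (rule integral_mono)
    have "integrable unit_interval (\<lambda>p. 2 * s - 2 * a p)"
      using a by simp
    then show "integrable unit_interval (\<lambda>p. (2 * s - 2 * a p) * indicator {y<..x} p)"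
      by (rule Bochner_Integration.integrable_bound) (simp_all add: indicator_def)
    show "integrable unit_interval (\<lambda>p. 2 * (s - c) * indicator {y<..x} p)"
      by (rule Bochner_Integration.integrable_bound[OF unit_interval.integrable_const[of "2 * (s - c)"]])
        (simp_all add: indicator_def)
    show "(2 * s - 2 * a p) * indicator {y<..x} p \<le> 2 * (s - c) * indicator {y<..x} p"
      if "p \<in> space unit_interval" for p
      using c[of p] that by (auto simp: indicator_def)
  qed
  also have "\<dots> = 2 * (s - c) * (x - y)"
  proof -
    have "(\<integral>p. indicator {y<..x} p \<partial>unit_interval)
        = (\<integral>p. (if y < p then 1 else 0) - (if x < p then 1 else 0 :: real) \<partial>unit_interval)"
      using x by (intro Bochner_Integration.integral_cong) (auto simp: indicator_def)
    also have "\<dots> = (1 - y) - (1 - x)"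
    proof -
      have "integrable unit_interval (\<lambda>p. (if t < p then 1 else 0 :: real))" for t
        by (rule Bochner_Integration.integrable_bound[OF unit_interval.integrable_const[of "1 :: real"]]) simp_all
      then show ?thesis
        using x by (simp add: integral_unit_interval_tail)
    qed
    finally show ?thesis by simp
  qed
  finally show False
    using x(3) \<open>\<not> c \<le> s\<close> by (simp add: zero_le_mult_iff)
qed

text \<open>Negating both \<open>a\<close> and \<open>s\<close> negates the cost, which exchanges
  the two end points and reduces the claim to \<open>level_cost_slope_le\<close>.\<close>

lemma level_cost_slope_ge:
  assumes a: "integrable unit_interval a" and x: "x \<in> {0..1}" "y \<in> {0..1}" "x < y"
    and c: "\<And>p. p \<in> {0<..<1} \<Longrightarrow> p \<in> {x<..y} \<Longrightarrow> a p \<le> c"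
    and le: "level_cost a s x \<le> level_cost a s y"
  shows "s \<le> c"
proof -
  have neg: "level_cost (\<lambda>p. - a p) (- s) t = - level_cost a s t" for t
    unfolding level_cost_def Bochner_Integration.integral_minus[symmetric]
    by (intro Bochner_Integration.integral_cong) (auto simp: algebra_simps)
  have "- c \<le> - s"
  proof (rule level_cost_slope_le[OF _ x, where a="\<lambda>p. - a p"])
    show "level_cost (\<lambda>p. - a p) (- s) y \<le> level_cost (\<lambda>p. - a p) (- s) x"
      using le by (simp only: neg neg_le_iff_le)
  qed (use a c in auto)
  then show ?thesis by simp
qed

text \<open>Suppose \<open>?z\<close> grows from \<open>p\<close> to \<open>q\<close> by more than
  \<open>u\<close> does. Take levels \<open>s\<close> just above \<open>?z p\<close> and
  \<open>s'\<close> just below \<open>?z q\<close>; their optimal end points satisfy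
  \<open>p <= x <= y < q\<close>. Optimality against points to the left of \<open>p\<close> gives
  \<open>u p - v x <= s\<close>, and optimality against \<open>q\<close> gives
  \<open>s' <= u q - v y\<close>. As \<open>v x <= v y\<close>, this yields
  \<open>s' - s <= u q - u p\<close>, a contradiction.\<close>

lemma mono_on_diff_isotonic:
  assumes u: "integrable unit_interval u" "mono_on {0<..<1} u"
    and left: "\<And>p c. p \<in> {0<..<1} \<Longrightarrow> (\<And>y. 0 < y \<Longrightarrow> y < p \<Longrightarrow> u y \<le> c) \<Longrightarrow> u p \<le> c"
    and v: "integrable unit_interval v" "mono_on {0<..<1} v"
  shows "mono_on {0<..<1} (\<lambda>p. u p - isotonic (\<lambda>p. u p - v p) p)"
proof (rule mono_onI, rule ccontr)
  let ?a = "\<lambda>p. u p - v p"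
  let ?z = "isotonic ?a"
  have a: "integrable unit_interval ?a" using u v by simp
  fix p q :: real
  assume p: "p \<in> {0<..<1}" and q: "q \<in> {0<..<1}" and "p \<le> q"
    and neg: "\<not> u p - ?z p \<le> u q - ?z q"
  \<comment> \<open>A third of the excess growth: moving both levels inward by \<open>d\<close>
    leaves \<open>s' - s\<close> larger than \<open>u q - u p\<close> by exactly
    \<open>d\<close>.\<close>
  define d where "d = (?z q - ?z p - (u q - u p)) / 3"
  define s where "s = ?z p + d"
  define s' where "s' = ?z q - d"
  have d: "0 < d" using neg by (simp add: d_def)
  have uq: "u p \<le> u q" using mono_onD[OF u(2) p q \<open>p \<le> q\<close>] .
  have ss': "u q - u p < s' - s" using d by (simp add: s_def s'_def d_def field_simps)
  define x where "x = level_point ?a s"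
  define y where "y = level_point ?a s'"
  have "p \<le> x" unfolding x_def using level_point_ge[OF a p] d by (simp add: s_def)
  have "y < q" unfolding y_def using level_point_less[OF a q] d by (simp add: s'_def)
  have "x \<le> y" unfolding x_def y_def using ss' uq by (intro monoD[OF level_point_mono[OF a]]) simp
  have x: "x \<in> {0<..<1}" and y: "y \<in> {0<..<1}"
    using \<open>p \<le> x\<close> \<open>x \<le> y\<close> \<open>y < q\<close> p q by auto
  have "u p \<le> s + v x"
  proof (rule left[OF p])
    fix t assume t: "0 < t" "t < p"
    \<comment> \<open>Starting strictly left of \<open>p\<close> keeps the segment from
      \<open>t\<close> to \<open>x\<close> nondegenerate even if \<open>x = p\<close>; left
      continuity of \<open>u\<close> then recovers the bound at \<open>p\<close>.\<close>
    have "u t - v x \<le> s"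
    proof (rule level_cost_slope_le[OF a, of t x])
      show "t \<in> {0..1}" "x \<in> {0..1}" "t < x" using t x p \<open>p \<le> x\<close> by auto
      then show "level_cost ?a s x \<le> level_cost ?a s t"
        unfolding x_def by (intro level_point_le[OF a])
      fix r assume r: "r \<in> {0<..<1}" "r \<in> {t<..x}"
      then show "u t - v x \<le> u r - v r"
        using t p x by (intro diff_mono mono_onD[OF u(2)] mono_onD[OF v(2)]) auto
    qed
    then show "u t \<le> s + v x" by simp
  qed
  moreover have "v x \<le> v y"
    using mono_onD[OF v(2) x y \<open>x \<le> y\<close>] .
  moreover have "s' \<le> u q - v y"
  proof (rule level_cost_slope_ge[OF a, of y q])
    show "y \<in> {0..1}" "q \<in> {0..1}" "y < q" using y q \<open>y < q\<close> by auto
    then show "level_cost ?a s' y \<le> level_cost ?a s' q"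
      unfolding y_def by (intro level_point_le[OF a])
    fix r assume r: "r \<in> {0<..<1}" "r \<in> {y<..q}"
    then show "u r - v r \<le> u q - v y"
      using q y by (intro diff_mono mono_onD[OF u(2)] mono_onD[OF v(2)]) auto
  qed
  ultimately show False using ss' by simp
qed

subsection \<open>Convex order\<close>

lemma ext_integral_integrable:
  assumes "integrable M f"
  shows "ext_integral M f = ereal (\<integral>x. f x \<partial>M)"
proof -
  from assms obtain r q where "0 \<le> r" "0 \<le> q" "(\<integral>\<^sup>+x. ennreal (f x) \<partial>M) = ennreal r"
    "(\<integral>\<^sup>+x. ennreal (- f x) \<partial>M) = ennreal q" "(\<integral>x. f x \<partial>M) = r - q"
    by (rule integrableE)
  then show ?thesis
    by (simp add: ext_integral_def)
qed

text \<open>Intended for a convex function split into an affine minorant \<open>l\<close> and the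
  nonnegative remainder \<open>g\<close>. If \<open>g\<close> has infinite integral, the integrable
  \<open>l\<close> cannot compensate for it, and the negative part of the sum is dominated by
  \<open>\<bar>l x\<bar>\<close>.\<close>

lemma ext_integral_add:
  assumes g: "g \<in> borel_measurable M" "\<And>x. x \<in> space M \<Longrightarrow> 0 \<le> g x" and l: "integrable M l"
  shows "ext_integral M (\<lambda>x. g x + l x) = enn2ereal (\<integral>\<^sup>+x. ennreal (g x) \<partial>M) + ereal (\<integral>x. l x \<partial>M)"
proof (cases "(\<integral>\<^sup>+x. ennreal (g x) \<partial>M) < \<infinity>")
  case True
  have int: "integrable M g"
    using g True by (intro integrableI_nonneg AE_I2) auto
  have "(\<integral>\<^sup>+x. ennreal (g x) \<partial>M) = ennreal (\<integral>x. g x \<partial>M)"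
    using g by (intro nn_integral_eq_integral int AE_I2)
  moreover have "0 \<le> (\<integral>x. g x \<partial>M)"
    using g by (intro integral_nonneg_AE AE_I2)
  ultimately show ?thesis
    using int l by (subst ext_integral_integrable) (auto simp: enn2ereal_ennreal)
next
  case False
  note [measurable] = g(1) borel_measurable_integrable[OF l]
  have fin: "(\<integral>\<^sup>+x. ennreal \<bar>l x\<bar> \<partial>M) < \<infinity>"
    using l by (simp add: integrable_iff_bounded)
  have "\<infinity> = (\<integral>\<^sup>+x. ennreal (g x) \<partial>M)"
    by (metis False infinity_ennreal_def top.not_eq_extremum)
  also have "\<dots> \<le> (\<integral>\<^sup>+x. ennreal (g x + l x) + ennreal \<bar>l x\<bar> \<partial>M)"
  proof (rule nn_integral_mono)
    fix x
    have "ennreal (g x) \<le> ennreal (max 0 (g x + l x) + \<bar>l x\<bar>)"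
      by (rule ennreal_leI) auto
    also have "\<dots> = ennreal (g x + l x) + ennreal \<bar>l x\<bar>"
      by (subst ennreal_plus) (auto simp: max_def ennreal_neg)
    finally show "ennreal (g x) \<le> ennreal (g x + l x) + ennreal \<bar>l x\<bar>" .
  qed
  also have "\<dots> = (\<integral>\<^sup>+x. ennreal (g x + l x) \<partial>M) + (\<integral>\<^sup>+x. ennreal \<bar>l x\<bar> \<partial>M)"
    by (rule nn_integral_add) measurable
  finally have pos: "(\<integral>\<^sup>+x. ennreal (g x + l x) \<partial>M) = \<infinity>"
    using fin by (auto simp: top_unique)
  have "(\<integral>\<^sup>+x. ennreal (- (g x + l x)) \<partial>M) \<le> (\<integral>\<^sup>+x. ennreal \<bar>l x\<bar> \<partial>M)"
    using g(2) by (intro nn_integral_mono ennreal_leI) (auto simp: abs_if dest!: g(2))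
  with fin have "(\<integral>\<^sup>+x. ennreal (- (g x + l x)) \<partial>M) < \<infinity>"
    by (rule order_le_less_trans[rotated])
  then have "\<exists>q. (\<integral>\<^sup>+x. ennreal (- (g x + l x)) \<partial>M) = ennreal q \<and> 0 \<le> q"
    by (cases "\<integral>\<^sup>+x. ennreal (- (g x + l x)) \<partial>M") auto
  then obtain q where "(\<integral>\<^sup>+x. ennreal (- (g x + l x)) \<partial>M) = ennreal q" "0 \<le> q"
    by blast
  then show ?thesis
    using False pos by (simp add: ext_integral_def top.not_eq_extremum[symmetric])
qed

lemma ext_integral_distr:
  assumes "f \<in> borel_measurable M" "\<phi> \<in> borel_measurable borel"
  shows "ext_integral (distr M borel f) \<phi> = ext_integral M (\<lambda>x. \<phi> (f x))"
  using assms by (simp add: ext_integral_def nn_integral_distr)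

text \<open>The identity and its negative are convex, so the means agree. Hinge functions compare
  the integrals of the two quantile functions over each final segment. These are the hypotheses of
  \<open>integral_mult_mono_on_nonneg\<close>.\<close>

lemma convex_order_imp_polar:
  assumes \<eta>: "\<eta> \<in> P2" and \<nu>: "\<nu> \<in> P2" and cx: "\<eta> \<le>cx \<nu>"
    and f: "square_integrable unit_interval f" "mono_on {0<..<1} f"
  shows "0 \<le> (\<integral>p. f p * (quantile \<nu> p - quantile \<eta> p) \<partial>unit_interval)"
proof -
  let ?w = "quantile \<eta>" and ?v = "quantile \<nu>"
  note w = P2_quantile[OF \<eta>] and v = P2_quantile[OF \<nu>]
  note [measurable] = square_integrable_measurable[OF w] square_integrable_measurable[OF v]
  have wi: "integrable unit_interval ?w" and vi: "integrable unit_interval ?v"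
    by (rule unit_interval.square_integrable_integrable[OF w]
        unit_interval.square_integrable_integrable[OF v])+
  have dw: "distr unit_interval borel ?w = \<eta>" and dv: "distr unit_interval borel ?v = \<nu>"
    by (simp_all add: distr_quantile P2_real_distribution \<eta> \<nu>)
  have le: "(\<integral>p. \<phi> (?w p) \<partial>unit_interval) \<le> (\<integral>p. \<phi> (?v p) \<partial>unit_interval)"
    if \<phi>: "convex_on UNIV \<phi>" "\<phi> \<in> borel_measurable borel"
      and int: "integrable unit_interval (\<lambda>p. \<phi> (?w p))" "integrable unit_interval (\<lambda>p. \<phi> (?v p))" for \<phi>
  proof -
    have "ext_integral \<eta> \<phi> \<le> ext_integral \<nu> \<phi>"
      using cx \<phi>(1) by (simp add: convex_order_def)
    moreover have "ext_integral \<eta> \<phi> = ext_integral unit_interval (\<lambda>p. \<phi> (?w p))"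
      by (subst dw[symmetric]) (intro ext_integral_distr \<phi>; measurable)
    moreover have "ext_integral \<nu> \<phi> = ext_integral unit_interval (\<lambda>p. \<phi> (?v p))"
      by (subst dv[symmetric]) (intro ext_integral_distr \<phi>; measurable)
    ultimately show ?thesis
      by (simp only: ext_integral_integrable[OF int(1)] ext_integral_integrable[OF int(2)] ereal_less_eq)
  qed
  have mean: "(\<integral>p. ?w p \<partial>unit_interval) = (\<integral>p. ?v p \<partial>unit_interval)"
    using le[of "\<lambda>x. x"] le[of "\<lambda>x. - x"] wi vi
    by (simp add: convex_on_def)
  have hinge: "(\<integral>p. max 0 (?w p - t) \<partial>unit_interval) \<le> (\<integral>p. max 0 (?v p - t) \<partial>unit_interval)" for t
  proof (rule le)
    show "convex_on UNIV (\<lambda>x. max 0 (x - t))"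
    proof (rule convex_onI)
      fix s x y :: real assume s: "0 < s" "s < 1"
      have "(1 - s) * (x - t) \<le> (1 - s) * max 0 (x - t)" "s * (y - t) \<le> s * max 0 (y - t)"
        "0 \<le> (1 - s) * max 0 (x - t)" "0 \<le> s * max 0 (y - t)"
        using s by (auto intro!: mult_left_mono)
      then have "(1 - s) * (x - t) + s * (y - t) \<le> (1 - s) * max 0 (x - t) + s * max 0 (y - t)"
        "0 \<le> (1 - s) * max 0 (x - t) + s * max 0 (y - t)"
        by linarith+
      moreover have "(1 - s) *\<^sub>R x + s *\<^sub>R y - t = (1 - s) * (x - t) + s * (y - t)"
        by (simp add: algebra_simps)
      ultimately show "max 0 ((1 - s) *\<^sub>R x + s *\<^sub>R y - t) \<le> (1 - s) * max 0 (x - t) + s * max 0 (y - t)"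
        by (simp only: max.bounded_iff)
    qed simp
    show "integrable unit_interval (\<lambda>p. max 0 (?w p - t))" "integrable unit_interval (\<lambda>p. max 0 (?v p - t))"
      using wi vi by auto
  qed measurable
  show ?thesis
  proof (rule integral_mult_mono_on_nonneg[OF square_integrable_diff[OF v w] _ _ f])
    show int0: "(\<integral>p. ?v p - ?w p \<partial>unit_interval) = 0"
      using wi vi mean by simp
    fix x :: real assume x: "x \<in> {0..1}"
    have tail: "integrable unit_interval (\<lambda>p. h p * (if x < p then 1 else 0))"
      if "integrable unit_interval h" for h :: "real \<Rightarrow> real"
      by (rule Bochner_Integration.integrable_bound[OF that])
        (use borel_measurable_integrable[OF that] in simp_all)
    consider "x = 0" | "x = 1" | "x \<in> {0<..<1}" using x by force
    then show "0 \<le> (\<integral>p. (?v p - ?w p) * (if x < p then 1 else 0) \<partial>unit_interval)"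
    proof cases
      case 1
      then have "(\<integral>p. (?v p - ?w p) * (if x < p then 1 else 0) \<partial>unit_interval)
          = (\<integral>p. ?v p - ?w p \<partial>unit_interval)"
        by (intro Bochner_Integration.integral_cong) auto
      then show ?thesis using int0 by simp
    next
      case 2
      then have "(\<integral>p. (?v p - ?w p) * (if x < p then 1 else 0) \<partial>unit_interval)
          = (\<integral>p. 0 \<partial>unit_interval)"
        by (intro Bochner_Integration.integral_cong) auto
      then show ?thesis by simp
    next
      case 3
      \<comment> \<open>At this threshold the hinge of \<open>?v\<close> vanishes before
        \<open>x\<close> and equals \<open>?v p - t\<close> after it, so its integral is exactly the
        tail integral. For \<open>?w\<close> the hinge only dominates the tail integrand, which is
        the direction required.\<close>
      define t where "t = ?v x"
      have "(\<integral>p. (?w p - t) * (if x < p then 1 else 0) \<partial>unit_interval)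
          \<le> (\<integral>p. max 0 (?w p - t) \<partial>unit_interval)"
        using wi by (intro integral_mono tail) auto
      also have "\<dots> \<le> (\<integral>p. max 0 (?v p - t) \<partial>unit_interval)"
        by (rule hinge)
      also have "\<dots> = (\<integral>p. (?v p - t) * (if x < p then 1 else 0) \<partial>unit_interval)"
      proof (rule Bochner_Integration.integral_cong)
        fix p assume p: "p \<in> space unit_interval"
        have "x < p \<Longrightarrow> t \<le> ?v p" "p \<le> x \<Longrightarrow> ?v p \<le> t"
          using mono_onD[OF mono_on_quantile[OF P2_real_distribution[OF \<nu>]]] p 3
          by (auto simp: t_def)
        then show "max 0 (?v p - t) = (?v p - t) * (if x < p then 1 else 0)"
          by (cases "x < p") auto
      qed simp
      finally have "0 \<le> (\<integral>p. (?v p - t) * (if x < p then 1 else 0) \<partial>unit_interval)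
          - (\<integral>p. (?w p - t) * (if x < p then 1 else 0) \<partial>unit_interval)"
        by simp
      also have "\<dots> = (\<integral>p. (?v p - t) * (if x < p then 1 else 0)
          - (?w p - t) * (if x < p then 1 else 0) \<partial>unit_interval)"
        using wi vi by (intro Bochner_Integration.integral_diff[symmetric] tail) auto
      also have "\<dots> = (\<integral>p. (?v p - ?w p) * (if x < p then 1 else 0) \<partial>unit_interval)"
        by (intro Bochner_Integration.integral_cong) auto
      finally show ?thesis .
    qed
  qed
qed

section \<open>From polarity to the convex order\<close>

text \<open>Any selection of subgradients is nondecreasing: add the subgradient inequalities at
  \<open>x\<close> and at \<open>y\<close>.\<close>

lemma convex_on_subgradient:
  fixes \<phi> :: "real \<Rightarrow> real"
  assumes "convex_on UNIV \<phi>"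
  obtains g where "\<And>x y. \<phi> x + g x * (y - x) \<le> \<phi> y" "mono g"
proof -
  have "\<forall>x. \<exists>c. \<forall>y. \<phi> x + c * (y - x) \<le> \<phi> y"
    using convex_le_Inf_differential[OF assms] by fastforce
  then obtain g where g: "\<And>x y. \<phi> x + g x * (y - x) \<le> \<phi> y"
    by metis
  have "mono g"
  proof (rule monoI)
    fix x y :: real assume "x \<le> y"
    show "g x \<le> g y"
    proof (cases "x = y")
      case False
      have "(g x - g y) * (y - x) \<le> 0"
        using g[of x y] g[of y x] by (simp add: algebra_simps)
      with False \<open>x \<le> y\<close> show ?thesis by (simp add: mult_le_0_iff)
    qed simp
  qed
  with g show ?thesis by (rule that)
qed

text \<open>Truncating \<open>w\<close> before applying the subgradient inequality makes the subgradients a bounded,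
  hence admissible, nondecreasing test function.\<close>

lemma polar_imp_nn_integral_le:
  assumes w: "square_integrable unit_interval w" "mono_on {0<..<1} w"
    and v: "square_integrable unit_interval v"
    and polar: "\<And>f. square_integrable unit_interval f \<Longrightarrow> mono_on {0<..<1} f \<Longrightarrow>
      (\<integral>p. (w p - v p) * f p \<partial>unit_interval) \<le> 0"
    and \<psi>: "\<And>x y. \<psi> x + h x * (y - x) \<le> \<psi> y" "mono h" "h 0 = 0" "\<And>x. 0 \<le> \<psi> x"
    and cont: "continuous_on UNIV \<psi>"
  shows "(\<integral>\<^sup>+p. ennreal (\<psi> (w p)) \<partial>unit_interval) \<le> (\<integral>\<^sup>+p. ennreal (\<psi> (v p)) \<partial>unit_interval)"
proof (cases "(\<integral>\<^sup>+p. ennreal (\<psi> (v p)) \<partial>unit_interval) < \<infinity>")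
  case True
  note [measurable] = square_integrable_measurable[OF w(1)] square_integrable_measurable[OF v]
    borel_measurable_continuous_onI[OF cont] borel_measurable_mono[OF \<psi>(2)]
  have int_v: "integrable unit_interval (\<lambda>p. \<psi> (v p))"
    using True \<psi>(4) by (intro integrableI_nonneg) auto
  have bound: "(\<integral>\<^sup>+p. ennreal (\<psi> (clamp_real N (w p))) \<partial>unit_interval) \<le> (\<integral>\<^sup>+p. ennreal (\<psi> (v p)) \<partial>unit_interval)"
    if N: "0 \<le> N" for N
  proof -
    let ?f = "\<lambda>p. h (clamp_real N (w p))"
    have f_mono: "mono_on {0<..<1} ?f"
      using mono_on_clamp_real[OF w(2), of N] monoD[OF \<psi>(2)] by (auto simp: mono_on_def)
    have h_bound: "\<bar>h (clamp_real N y)\<bar> \<le> max \<bar>h N\<bar> \<bar>h (- N)\<bar>" for y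
      using clamp_real_bounds[OF N, of y] monoD[OF \<psi>(2), of "- N" "clamp_real N y"]
        monoD[OF \<psi>(2), of "clamp_real N y" N] by auto
    have f_sq: "square_integrable unit_interval ?f"
      by (rule square_integrable_bound[OF unit_interval.square_integrable_const[of "max \<bar>h N\<bar> \<bar>h (- N)\<bar>"]])
        (use h_bound in \<open>auto simp: le_max_iff_disj\<close>)
    have le: "\<psi> (clamp_real N (w p)) \<le> \<psi> (v p) + (w p - v p) * ?f p" for p
    proof -
      \<comment> \<open>Where truncation acts, \<open>?f p\<close> has the sign of the removed part
        \<open>w p - clamp_real N (w p)\<close>, or is zero, because \<open>h\<close> is
        nondecreasing and \<open>h 0 = 0\<close>. The truncated value may thus be replaced by
        \<open>w p\<close> in the linear term.\<close>
      have "0 \<le> ?f p * (w p - clamp_real N (w p))"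
        using N monoD[OF \<psi>(2), of 0 N] monoD[OF \<psi>(2), of "- N" 0] \<psi>(3)
        by (auto simp: clamp_real_def max_def min_def zero_le_mult_iff)
      with \<psi>(1)[of "clamp_real N (w p)" "v p"] show ?thesis
        by (simp add: algebra_simps)
    qed
    have int_f: "integrable unit_interval (\<lambda>p. (w p - v p) * ?f p)"
      by (rule square_integrable_mult[OF square_integrable_diff[OF w(1) v] f_sq])
    have int_r: "integrable unit_interval (\<lambda>p. \<psi> (v p) + (w p - v p) * ?f p)"
      using int_v int_f by simp
    have int_w: "integrable unit_interval (\<lambda>p. \<psi> (clamp_real N (w p)))"
    proof (rule Bochner_Integration.integrable_bound[OF int_r])
      show "AE p in unit_interval. norm (\<psi> (clamp_real N (w p))) \<le> norm (\<psi> (v p) + (w p - v p) * ?f p)"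
      proof (rule AE_I2)
        fix p
        show "norm (\<psi> (clamp_real N (w p))) \<le> norm (\<psi> (v p) + (w p - v p) * ?f p)"
          using le[of p] \<psi>(4)[of "clamp_real N (w p)"] by simp
      qed
    qed measurable
    have "(\<integral>p. \<psi> (clamp_real N (w p)) \<partial>unit_interval) \<le> (\<integral>p. \<psi> (v p) + (w p - v p) * ?f p \<partial>unit_interval)"
      by (rule integral_mono[OF int_w int_r le])
    also have "\<dots> = (\<integral>p. \<psi> (v p) \<partial>unit_interval) + (\<integral>p. (w p - v p) * ?f p \<partial>unit_interval)"
      by (rule Bochner_Integration.integral_add[OF int_v int_f])
    also have "\<dots> \<le> (\<integral>p. \<psi> (v p) \<partial>unit_interval)"
      using polar[OF f_sq f_mono] by simp
    finally show ?thesis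
      using \<psi>(4) by (simp add: nn_integral_eq_integral int_v int_w ennreal_leI)
  qed
  have "(\<integral>\<^sup>+p. ennreal (\<psi> (w p)) \<partial>unit_interval)
      = (\<integral>\<^sup>+p. liminf (\<lambda>n. ennreal (\<psi> (clamp_real (real n) (w p)))) \<partial>unit_interval)"
    by (intro nn_integral_cong lim_imp_Liminf[symmetric] tendsto_ennrealI
        continuous_on_tendsto_compose[OF cont] clamp_real_tendsto) simp_all
  also have "\<dots> \<le> liminf (\<lambda>n. \<integral>\<^sup>+p. ennreal (\<psi> (clamp_real (real n) (w p))) \<partial>unit_interval)"
    by (rule nn_integral_liminf) measurable
  also have "\<dots> \<le> (\<integral>\<^sup>+p. ennreal (\<psi> (v p)) \<partial>unit_interval)"
    by (intro Liminf_le always_eventually allI bound) simp_all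
  finally show ?thesis .
next
  case False
  then have "(\<integral>\<^sup>+p. ennreal (\<psi> (v p)) \<partial>unit_interval) = \<infinity>"
    by (metis infinity_ennreal_def top.not_eq_extremum)
  then show ?thesis by simp
qed

text \<open>Subtracting a supporting line at 0 leaves a nonnegative convex function with subgradient
  0 at 0, to which \<open>polar_imp_nn_integral_le\<close> applies even when integrals are infinite.
  The line contributes equally on both sides, since polarity against constants of both signs makes
  the means equal.\<close>

lemma polar_imp_convex_order:
  assumes w: "square_integrable unit_interval w" "mono_on {0<..<1} w"
    and v: "square_integrable unit_interval v"
    and polar: "\<And>f. square_integrable unit_interval f \<Longrightarrow> mono_on {0<..<1} f \<Longrightarrow>
      (\<integral>p. (w p - v p) * f p \<partial>unit_interval) \<le> 0"
  shows "distr unit_interval borel w \<le>cx distr unit_interval borel v"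
  unfolding convex_order_def
proof (intro allI impI)
  fix \<phi> :: "real \<Rightarrow> real" assume \<phi>: "convex_on UNIV \<phi>"
  obtain g where g: "\<And>x y. \<phi> x + g x * (y - x) \<le> \<phi> y" "mono g"
    using convex_on_subgradient[OF \<phi>] by blast
  have cont: "continuous_on UNIV \<phi>"
    by (rule convex_on_continuous[OF _ \<phi>]) simp
  note [measurable] = square_integrable_measurable[OF w(1)] square_integrable_measurable[OF v]
    borel_measurable_continuous_onI[OF cont]
  have wi: "integrable unit_interval w" and vi: "integrable unit_interval v"
    by (rule unit_interval.square_integrable_integrable[OF w(1)]
        unit_interval.square_integrable_integrable[OF v])+
  define \<psi> where "\<psi> = (\<lambda>x. \<phi> x - \<phi> 0 - g 0 * x)"
  define l where "l = (\<lambda>x. \<phi> 0 + g 0 * x)"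
  have \<psi>_nonneg: "0 \<le> \<psi> x" for x
    using g(1)[of 0 x] by (simp add: \<psi>_def)
  have nn: "(\<integral>\<^sup>+p. ennreal (\<psi> (w p)) \<partial>unit_interval) \<le> (\<integral>\<^sup>+p. ennreal (\<psi> (v p)) \<partial>unit_interval)"
  proof (rule polar_imp_nn_integral_le[OF w v polar, where h="\<lambda>x. g x - g 0"])
    show "\<psi> x + (g x - g 0) * (y - x) \<le> \<psi> y" for x y
      using g(1)[of x y] by (simp add: \<psi>_def algebra_simps)
    show "mono (\<lambda>x. g x - g 0)"
      using g(2) by (simp add: mono_def)
    show "continuous_on UNIV \<psi>"
      unfolding \<psi>_def by (intro continuous_intros cont)
  qed (use \<psi>_nonneg in simp_all)
  have mean: "(\<integral>p. w p \<partial>unit_interval) = (\<integral>p. v p \<partial>unit_interval)"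
  proof -
    have "(\<integral>p. (w p - v p) * d \<partial>unit_interval) \<le> 0" for d
      by (rule polar[OF unit_interval.square_integrable_const]) (simp add: mono_on_def)
    from this[of 1] this[of "-1"] show ?thesis
      unfolding integral_mult_left_zero using wi vi by simp
  qed
  have eq: "ext_integral (distr unit_interval borel f) \<phi>
      = enn2ereal (\<integral>\<^sup>+p. ennreal (\<psi> (f p)) \<partial>unit_interval) + ereal (\<phi> 0 + g 0 * (\<integral>p. f p \<partial>unit_interval))"
    if f: "integrable unit_interval f" for f
  proof -
    note [measurable] = borel_measurable_integrable[OF f]
    have "ext_integral (distr unit_interval borel f) \<phi> = ext_integral unit_interval (\<lambda>p. \<psi> (f p) + l (f p))"
      by (subst ext_integral_distr) (simp_all add: \<psi>_def l_def)
    also have "\<dots> = enn2ereal (\<integral>\<^sup>+p. ennreal (\<psi> (f p)) \<partial>unit_interval) + ereal (\<integral>p. l (f p) \<partial>unit_interval)"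
      using f \<psi>_nonneg by (intro ext_integral_add) (auto simp: \<psi>_def l_def)
    also have "(\<integral>p. l (f p) \<partial>unit_interval) = \<phi> 0 + g 0 * (\<integral>p. f p \<partial>unit_interval)"
      using f unit_interval.prob_space by (simp add: l_def)
    finally show ?thesis .
  qed
  show "ext_integral (distr unit_interval borel w) \<phi> \<le> ext_integral (distr unit_interval borel v) \<phi>"
    unfolding eq[OF wi] eq[OF vi] mean
    by (rule add_right_mono) (use nn in \<open>simp only: less_eq_ennreal.rep_eq\<close>)
qed

lemma W2_nonneg: "0 \<le> W2 \<mu> \<nu>"
  by (simp add: W2_def)

subsection \<open>The projection in the convex order\<close>

definition projection_quantile :: "real measure \<Rightarrow> real measure \<Rightarrow> real \<Rightarrow> real" where
  "projection_quantile \<mu> \<nu> p = quantile \<mu> p - isotonic (\<lambda>p. quantile \<mu> p - quantile \<nu> p) p"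

context
  fixes \<mu> \<nu> :: "real measure"
  assumes \<mu>: "\<mu> \<in> P2" and \<nu>: "\<nu> \<in> P2"
begin

private abbreviation (input) "u \<equiv> quantile \<mu>"
private abbreviation (input) "v \<equiv> quantile \<nu>"
private abbreviation (input) "a \<equiv> (\<lambda>p. quantile \<mu> p - quantile \<nu> p)"
private abbreviation (input) "w \<equiv> projection_quantile \<mu> \<nu>"

lemma square_integrable_quantile_diff: "square_integrable unit_interval a"
  by (intro square_integrable_diff P2_quantile \<mu> \<nu>)

lemma square_integrable_projection_quantile: "square_integrable unit_interval w"
  unfolding projection_quantile_def[abs_def]
  by (intro square_integrable_diff P2_quantile[OF \<mu>] square_integrable_isotonic square_integrable_quantile_diff)

lemma mono_on_projection_quantile: "mono_on {0<..<1} w"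
  unfolding projection_quantile_def[abs_def]
proof (rule mono_on_diff_isotonic)
  show "quantile \<mu> p \<le> c" if "p \<in> {0<..<1}" "\<And>y. 0 < y \<Longrightarrow> y < p \<Longrightarrow> quantile \<mu> y \<le> c" for p c
    using that(1) by (intro quantile_left_continuous[OF P2_real_distribution[OF \<mu>] _ _ that(2)]) simp_all
qed (intro unit_interval.square_integrable_integrable P2_quantile
    mono_on_quantile P2_real_distribution \<mu> \<nu>)+

private lemma residual_eq: "w p - v p = a p - isotonic a p"
  by (simp add: projection_quantile_def)

lemma projection_quantile_polar:
  assumes "square_integrable unit_interval f" "mono_on {0<..<1} f"
  shows "(\<integral>p. (w p - v p) * f p \<partial>unit_interval) \<le> 0"
  unfolding residual_eq by (rule isotonic_residual_polar[OF square_integrable_quantile_diff assms])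

lemma projection_quantile_convex_order: "distr unit_interval borel w \<le>cx \<nu>"
  using polar_imp_convex_order[OF square_integrable_projection_quantile mono_on_projection_quantile
      P2_quantile[OF \<nu>] projection_quantile_polar]
  by (simp add: distr_quantile P2_real_distribution \<nu>)

text \<open>Pythagorean inequality for a projection; its extra term yields uniqueness besides
  minimality. The cross term pairs \<open>?z\<close> with
  \<open>w - ?y = (w - v) + (v - ?y)\<close>: the first summand is the residual, orthogonal to
  \<open>?z\<close>, and the second pairs nonnegatively with the nondecreasing \<open>?z\<close>
  because \<open>\<eta> \<le>cx \<nu>\<close>.\<close>

lemma W2_projection_quantile_le:
  assumes \<eta>: "\<eta> \<in> P2" "\<eta> \<le>cx \<nu>"
  shows "(W2 \<mu> (distr unit_interval borel w))\<^sup>2 + (\<integral>p. (w p - quantile \<eta> p)\<^sup>2 \<partial>unit_interval) \<le> (W2 \<mu> \<eta>)\<^sup>2"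
proof -
  let ?z = "isotonic a" and ?y = "quantile \<eta>"
  note z = square_integrable_isotonic[OF square_integrable_quantile_diff]
  note w = square_integrable_projection_quantile and v = P2_quantile[OF \<nu>] and y = P2_quantile[OF \<eta>(1)]
  note wy = square_integrable_diff[OF w y]
  have z_mono: "mono_on {0<..<1} ?z"
    by (intro mono_on_isotonic unit_interval.square_integrable_integrable square_integrable_quantile_diff)
  have "W2 (distr unit_interval borel u) (distr unit_interval borel w) \<le> l2norm unit_interval (\<lambda>p. u p - w p)"
    by (rule W2_distr_le[OF unit_interval.prob_space_axioms P2_quantile[OF \<mu>] w])
  then have "W2 \<mu> (distr unit_interval borel w) \<le> l2norm unit_interval ?z"
    by (simp add: distr_quantile P2_real_distribution \<mu> projection_quantile_def)
  then have 1: "(W2 \<mu> (distr unit_interval borel w))\<^sup>2 \<le> (\<integral>p. (?z p)\<^sup>2 \<partial>unit_interval)"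
    by (simp only: l2norm_power2[symmetric]) (rule power_mono[OF _ W2_nonneg])
  have "0 \<le> (\<integral>p. (a p - ?z p) * ?z p \<partial>unit_interval) + (\<integral>p. ?z p * (v p - ?y p) \<partial>unit_interval)"
    using convex_order_imp_polar[OF \<eta>(1) \<nu> \<eta>(2) z z_mono]
    by (simp add: isotonic_residual_orthogonal[OF square_integrable_quantile_diff])
  also have "\<dots> = (\<integral>p. (a p - ?z p) * ?z p + ?z p * (v p - ?y p) \<partial>unit_interval)"
    by (intro Bochner_Integration.integral_add[symmetric] square_integrable_mult square_integrable_diff
        square_integrable_quantile_diff z v y)
  also have "\<dots> = (\<integral>p. ?z p * (w p - ?y p) \<partial>unit_interval)"
    by (intro Bochner_Integration.integral_cong) (auto simp: projection_quantile_def algebra_simps)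
  finally have 2: "0 \<le> (\<integral>p. ?z p * (w p - ?y p) \<partial>unit_interval)" .
  have "(W2 \<mu> \<eta>)\<^sup>2 = (\<integral>p. (u p - ?y p)\<^sup>2 \<partial>unit_interval)"
    by (simp add: W2_quantile[OF \<mu> \<eta>(1)] l2norm_power2)
  also have "\<dots> = (\<integral>p. (?z p)\<^sup>2 + (w p - ?y p)\<^sup>2 + 2 * (?z p * (w p - ?y p)) \<partial>unit_interval)"
    by (intro Bochner_Integration.integral_cong)
      (auto simp: projection_quantile_def power2_eq_square algebra_simps)
  also have "\<dots> = (\<integral>p. (?z p)\<^sup>2 \<partial>unit_interval) + (\<integral>p. (w p - ?y p)\<^sup>2 \<partial>unit_interval)
      + 2 * (\<integral>p. ?z p * (w p - ?y p) \<partial>unit_interval)"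
    using square_integrable_square[OF z] square_integrable_square[OF wy] square_integrable_mult[OF z wy]
    by simp
  finally show ?thesis using 1 2 by simp
qed

text \<open>The Pythagorean inequality gives minimality. For any other minimizer it forces the
  distance between the quantile functions to vanish, so they agree almost everywhere and have the
  same law.\<close>

lemma cx_projection_eq: "cx_projection \<mu> \<nu> = distr unit_interval borel w"
  unfolding cx_projection_def
proof (rule the_equality)
  let ?\<eta> = "distr unit_interval borel w"
  note w = square_integrable_projection_quantile
  have feasible: "?\<eta> \<in> P2 \<and> ?\<eta> \<le>cx \<nu>"
    using P2_distr_iff[OF square_integrable_measurable[OF w] unit_interval.prob_space_axioms] w
      projection_quantile_convex_order by simp
  show "is_arg_min (W2 \<mu>) (\<lambda>\<eta>. \<eta> \<in> P2 \<and> \<eta> \<le>cx \<nu>) ?\<eta>"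
    unfolding is_arg_min_linorder
  proof (intro conjI allI impI)
    fix \<eta> assume "\<eta> \<in> P2 \<and> \<eta> \<le>cx \<nu>"
    then have "(W2 \<mu> ?\<eta>)\<^sup>2 + (\<integral>p. (w p - quantile \<eta> p)\<^sup>2 \<partial>unit_interval) \<le> (W2 \<mu> \<eta>)\<^sup>2"
      by (intro W2_projection_quantile_le) auto
    moreover have "0 \<le> (\<integral>p. (w p - quantile \<eta> p)\<^sup>2 \<partial>unit_interval)"
      by (rule integral_nonneg_AE) simp
    ultimately have "(W2 \<mu> ?\<eta>)\<^sup>2 \<le> (W2 \<mu> \<eta>)\<^sup>2"
      by linarith
    then show "W2 \<mu> ?\<eta> \<le> W2 \<mu> \<eta>"
      by (rule power2_le_imp_le) (rule W2_nonneg)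
  qed (use feasible in simp_all)
next
  let ?\<eta> = "distr unit_interval borel w"
  note w = square_integrable_projection_quantile
  fix \<eta> assume "is_arg_min (W2 \<mu>) (\<lambda>\<eta>. \<eta> \<in> P2 \<and> \<eta> \<le>cx \<nu>) \<eta>"
  then have \<eta>: "\<eta> \<in> P2" "\<eta> \<le>cx \<nu>"
    and min: "\<And>\<eta>'. \<eta>' \<in> P2 \<Longrightarrow> \<eta>' \<le>cx \<nu> \<Longrightarrow> W2 \<mu> \<eta> \<le> W2 \<mu> \<eta>'"
    unfolding is_arg_min_linorder by auto
  note y = P2_quantile[OF \<eta>(1)]
  note [measurable] = square_integrable_measurable[OF w] square_integrable_measurable[OF y]
  have "W2 \<mu> \<eta> \<le> W2 \<mu> ?\<eta>"
    using P2_distr_iff[OF square_integrable_measurable[OF w] unit_interval.prob_space_axioms] w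
      projection_quantile_convex_order by (intro min) simp_all
  then have "(W2 \<mu> \<eta>)\<^sup>2 \<le> (W2 \<mu> ?\<eta>)\<^sup>2"
    by (intro power_mono) (simp_all add: W2_nonneg)
  with W2_projection_quantile_le[OF \<eta>] have "(\<integral>p. (w p - quantile \<eta> p)\<^sup>2 \<partial>unit_interval) \<le> 0"
    by simp
  then have "(\<integral>p. (w p - quantile \<eta> p)\<^sup>2 \<partial>unit_interval) = 0"
    by (intro antisym integral_nonneg_AE) simp_all
  then have "AE p in unit_interval. (w p - quantile \<eta> p)\<^sup>2 = 0"
    using square_integrable_square[OF square_integrable_diff[OF w y]]
    by (subst (asm) integral_nonneg_eq_0_iff_AE) simp_all
  then have "distr unit_interval borel (quantile \<eta>) = ?\<eta>"
    by (intro distr_cong_AE) auto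
  then show "\<eta> = ?\<eta>"
    by (simp add: distr_quantile P2_real_distribution \<eta>)
qed

end

section \<open>The ball estimate and the contraction inequality\<close>

text \<open>The hypothesis says that \<open>h\<close> lies in the ball with diameter from \<open>f\<close> to \<open>g\<close>.\<close>

lemma l2norm_le_add_if_in_ball:
  assumes f: "square_integrable M f" and g: "square_integrable M g" and h: "square_integrable M h"
    and ball: "0 \<le> (\<integral>x. (f x - h x) * (h x - g x) \<partial>M)"
  shows "l2norm M h \<le> l2norm M f + l2norm M g"
proof -
  \<comment> \<open>Twice the displacement of \<open>h\<close> from the center of the ball. Its
    square is \<open>(f x - g x)^2 - 4 * ((f x - h x) * (h x - g x))\<close>, so the hypothesis
    bounds its norm by the diameter.\<close>
  let ?d = "\<lambda>x. 2 * h x - (f x + g x)"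
  have fg: "square_integrable M (\<lambda>x. f x - g x)" "square_integrable M (\<lambda>x. f x + g x)"
    by (intro square_integrable_diff square_integrable_add f g)+
  have d: "square_integrable M ?d"
    by (intro square_integrable_diff square_integrable_cmult fg h)
  have int: "integrable M (\<lambda>x. (f x - h x) * (h x - g x))"
    by (intro square_integrable_mult square_integrable_diff f g h)
  have "(\<integral>x. (?d x)\<^sup>2 \<partial>M) = (\<integral>x. (f x - g x)\<^sup>2 - 4 * ((f x - h x) * (h x - g x)) \<partial>M)"
    by (intro Bochner_Integration.integral_cong) (auto simp: power2_eq_square algebra_simps)
  also have "\<dots> \<le> (\<integral>x. (f x - g x)\<^sup>2 \<partial>M)"
    using int square_integrable_square[OF fg(1)] ball by simp
  finally have d_le: "l2norm M ?d \<le> l2norm M (\<lambda>x. f x - g x)"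
    by (simp add: l2norm_def)
  have "2 * l2norm M h = l2norm M (\<lambda>x. ?d x + (f x + g x))"
    by (simp add: l2norm_cmult)
  also have "\<dots> \<le> l2norm M ?d + l2norm M (\<lambda>x. f x + g x)"
    by (rule l2norm_triangle[OF d fg(2)])
  also have "\<dots> \<le> l2norm M (\<lambda>x. f x + -1 * g x) + l2norm M (\<lambda>x. f x + g x)"
    using d_le by simp
  also have "\<dots> \<le> (l2norm M f + l2norm M (\<lambda>x. -1 * g x)) + (l2norm M f + l2norm M g)"
    by (intro add_mono l2norm_triangle square_integrable_cmult f g)
  finally show ?thesis
    unfolding l2norm_cmult by simp
qed

text \<open>The variance formula for the difference of the quantile functions, whose mean is the
  difference of the means.\<close>

lemma centered_W2_quantile:
  assumes \<mu>: "\<mu> \<in> P2" and \<nu>: "\<nu> \<in> P2"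
  shows "centered_W2 \<mu> \<nu> = l2norm unit_interval (\<lambda>p. quantile \<mu> p - quantile \<nu> p - (mean \<mu> - mean \<nu>))"
proof -
  define c where "c = mean \<mu> - mean \<nu>"
  let ?a = "\<lambda>p. quantile \<mu> p - quantile \<nu> p"
  note a = square_integrable_quantile_diff[OF \<mu> \<nu>]
  have mean_a: "(\<integral>p. ?a p \<partial>unit_interval) = c"
    using unit_interval.square_integrable_integrable[OF P2_quantile[OF \<mu>]]
      unit_interval.square_integrable_integrable[OF P2_quantile[OF \<nu>]]
    by (simp add: c_def mean_quantile P2_real_distribution \<mu> \<nu>)
  have "(\<integral>p. (?a p - c)\<^sup>2 \<partial>unit_interval) = (\<integral>p. (?a p)\<^sup>2 - 2 * c * ?a p + c\<^sup>2 \<partial>unit_interval)"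
    by (intro Bochner_Integration.integral_cong) (auto simp: power2_eq_square algebra_simps)
  also have "\<dots> = (\<integral>p. (?a p)\<^sup>2 \<partial>unit_interval) - 2 * c * (\<integral>p. ?a p \<partial>unit_interval) + c\<^sup>2"
  proof -
    have i: "integrable unit_interval (\<lambda>p. 2 * c * ?a p)"
      by (intro integrable_mult_right unit_interval.square_integrable_integrable[OF a])
    have "(\<integral>p. (?a p)\<^sup>2 - 2 * c * ?a p + c\<^sup>2 \<partial>unit_interval)
        = (\<integral>p. (?a p)\<^sup>2 - 2 * c * ?a p \<partial>unit_interval) + (\<integral>p. c\<^sup>2 \<partial>unit_interval)"
      by (intro Bochner_Integration.integral_add Bochner_Integration.integrable_diff i square_integrable_square[OF a])
        simp
    also have "(\<integral>p. (?a p)\<^sup>2 - 2 * c * ?a p \<partial>unit_interval)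
        = (\<integral>p. (?a p)\<^sup>2 \<partial>unit_interval) - (\<integral>p. 2 * c * ?a p \<partial>unit_interval)"
      by (intro Bochner_Integration.integral_diff i square_integrable_square[OF a])
    also have "(\<integral>p. c\<^sup>2 \<partial>unit_interval) = c\<^sup>2"
      using unit_interval.prob_space by simp
    finally show ?thesis
      by (simp only: integral_mult_right_zero)
  qed
  also have "\<dots> = (W2 \<mu> \<nu>)\<^sup>2 - c\<^sup>2"
    unfolding mean_a unfolding W2_quantile[OF \<mu> \<nu>] l2norm_power2 by (simp add: power2_eq_square)
  finally show ?thesis
    by (simp add: centered_W2_def l2norm_def c_def)
qed

theorem corollary2p3:
  fixes \<mu> \<mu>' \<nu> \<nu>' :: "real measure"
  assumes "\<mu> \<in> P2" and "\<mu>' \<in> P2" and "\<nu> \<in> P2" and "\<nu>' \<in> P2"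
  shows "W2 (cx_projection \<mu> \<nu>) (cx_projection \<mu>' \<nu>') \<le> centered_W2 \<mu> \<mu>' + W2 \<nu> \<nu>'"
proof -
  define u where "u = quantile \<mu>"
  define u' where "u' = quantile \<mu>'"
  define v where "v = quantile \<nu>"
  define v' where "v' = quantile \<nu>'"
  define z where "z = isotonic (\<lambda>p. u p - v p)"
  define z' where "z' = isotonic (\<lambda>p. u' p - v' p)"
  define w where "w = projection_quantile \<mu> \<nu>"
  define w' where "w' = projection_quantile \<mu>' \<nu>'"
  define b where "b = (\<lambda>p. u p - v p - z p)"
  define b' where "b' = (\<lambda>p. u' p - v' p - z' p)"
  define c where "c = mean \<mu> - mean \<mu>'"
  note defs = u_def u'_def v_def v'_def
  have u: "square_integrable unit_interval u" and u': "square_integrable unit_interval u'"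
    and v: "square_integrable unit_interval v" and v': "square_integrable unit_interval v'"
    unfolding defs by (intro P2_quantile assms)+
  have w: "square_integrable unit_interval w" and w': "square_integrable unit_interval w'"
    unfolding w_def w'_def by (intro square_integrable_projection_quantile assms)+
  note a = square_integrable_diff[OF u v] and a' = square_integrable_diff[OF u' v']
  have z: "square_integrable unit_interval z" and z': "square_integrable unit_interval z'"
    unfolding z_def z'_def by (intro square_integrable_isotonic a a')+
  have b: "square_integrable unit_interval b" and b': "square_integrable unit_interval b'"
    unfolding b_def b'_def by (intro square_integrable_diff a a' z z')+
  have z_mono: "mono_on {0<..<1} z" "mono_on {0<..<1} z'"
    unfolding z_def z'_def
    by (intro mono_on_isotonic unit_interval.square_integrable_integrable a a')+
  have orth: "(\<integral>p. b p * z p \<partial>unit_interval) = 0" "(\<integral>p. b' p * z' p \<partial>unit_interval) = 0"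
    unfolding b_def b'_def z_def z'_def by (intro isotonic_residual_orthogonal a a')+
  have polar: "(\<integral>p. b p * z' p \<partial>unit_interval) \<le> 0" "(\<integral>p. b' p * z p \<partial>unit_interval) \<le> 0"
    using isotonic_residual_polar[OF a z' z_mono(2)] isotonic_residual_polar[OF a' z z_mono(1)]
    by (simp_all add: b_def b'_def z_def z'_def)
  have const: "(\<integral>p. b p * c \<partial>unit_interval) = 0" "(\<integral>p. b' p * c \<partial>unit_interval) = 0"
    unfolding b_def b'_def z_def z'_def by (intro isotonic_residual_const a a')+
  let ?C = "\<lambda>_::real. c"
  have c: "square_integrable unit_interval ?C" by (rule unit_interval.square_integrable_const)
  \<comment> \<open>Since \<open>u - w = z\<close> and \<open>w - v = b\<close>, the integrand is
    \<open>(z p - z' p - c) * (b p - b' p)\<close>. After expansion the diagonal terms vanish by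
    orthogonality and the terms with \<open>c\<close> by \<open>const\<close>, leaving the two mixed
    terms, whose signs are known by polarity.\<close>
  have "(\<integral>p. (u p - u' p - c - (w p - w' p)) * (w p - w' p - (v p - v' p)) \<partial>unit_interval)
     = (\<integral>p. b p * z p + b' p * z' p - b p * z' p - b' p * z p - b p * c + b' p * c \<partial>unit_interval)"
    by (intro Bochner_Integration.integral_cong)
      (auto simp: w_def w'_def b_def b'_def z_def z'_def defs projection_quantile_def algebra_simps)
  also have "\<dots> = - (\<integral>p. b p * z' p \<partial>unit_interval) - (\<integral>p. b' p * z p \<partial>unit_interval)"
    using square_integrable_mult[OF b z] square_integrable_mult[OF b z'] square_integrable_mult[OF b c]
      square_integrable_mult[OF b' z] square_integrable_mult[OF b' z'] square_integrable_mult[OF b' c]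
      orth const by auto
  also have "\<dots> \<ge> 0" using polar by simp
  finally have ball: "0 \<le> (\<integral>p. (u p - u' p - c - (w p - w' p)) * (w p - w' p - (v p - v' p)) \<partial>unit_interval)" .
  have "W2 (cx_projection \<mu> \<nu>) (cx_projection \<mu>' \<nu>') \<le> l2norm unit_interval (\<lambda>p. w p - w' p)"
    using W2_distr_le[OF unit_interval.prob_space_axioms w w']
    by (simp add: cx_projection_eq assms w_def w'_def)
  also have "\<dots> \<le> l2norm unit_interval (\<lambda>p. u p - u' p - c) + l2norm unit_interval (\<lambda>p. v p - v' p)"
    by (rule l2norm_le_add_if_in_ball[OF _ _ _ ball]) (intro square_integrable_diff u u' v v' w w' c)+
  also have "\<dots> = centered_W2 \<mu> \<mu>' + W2 \<nu> \<nu>'"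
    by (simp add: centered_W2_quantile W2_quantile assms defs c_def)
  finally show ?thesis .
qed

end
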